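(* Let $\mathbf{A} \in \mathbb{R}^{n \times d}$, $0 < \epsilon < 1$ and $p \geq 2$. Using $\widetilde{O}(p d/\epsilon)$ many $O(\epsilon/(pd))$-approximate leverage score computations, it is possible to compute a vector $w \in \mathbb{R}^n_{>0}$ that is a two-sided $\epsilon$-approximation of the $\ell_p$-Lewis weights of $\mathbf{A}$, i.e. \[ (1-\epsilon)\, \sigma(\mathbf{W}^{\frac12-\frac1p} \mathbf{A}) \leq w \leq (1+\epsilon)\, \sigma(\mathbf{W}^{\frac12-\frac1p} \mathbf{A}) \] entrywise, where $\mathbf{W} = \mathrm{Diag}(w)$.
   Context: For a matrix $\mathbf{B} \in \mathbb{R}^{n\times d}$ with rows $b_i^\top$, the leverage scores are $\sigma(\mathbf{B}) \in \mathbb{R}^n$ with $\sigma_i(\mathbf{B}) = b_i^\top (\mathbf{B}^\top \mathbf{B})^+ b_i$, where $^+$ denotes the Moore–Penrose pseudoinverse. Vector inequalities are entrywise. A $\delta$-approximate leverage score computation is a call that, given a vector $u \in \mathbb{R}^n_{>0}$, returns a vector $s$ with $(1-\delta)\sigma(\mathrm{Diag}(u)^{\frac12-\frac1p}\mathbf{A}) \leq s \leq (1+\delta)\sigma(\mathrm{Diag}(u)^{\frac12-\frac1p}\mathbf{A})$ entrywise. $\widetilde{O}$ hides polylogarithmic factors (here in $n/d$ and the other parameters).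
   Formalization: The matrix A is assumed to have no zero row (and n, d ≥ 1): for a zero row the leverage score is 0, so no w with positive entries can satisfy w ≤ (1+ε)σ, and the claim fails for every such A. *)

theory Defs
  imports Complex_Main "Jordan_Normal_Form.Matrix"
begin

section \<open>Leverage scores and Lewis weights\<close>

definition is_pinv :: "real mat \<Rightarrow> real mat \<Rightarrow> bool" where
  "is_pinv M X \<longleftrightarrow>
     X \<in> carrier_mat (dim_col M) (dim_row M) \<and>
     M * X * M = M \<and> X * M * X = X \<and>
     transpose_mat (M * X) = M * X \<and> transpose_mat (X * M) = X * M"

text \<open>The four Penrose equations determine the pseudoinverse of a real matrix uniquely.\<close>

definition pinv :: "real mat \<Rightarrow> real mat" where
  "pinv M = (THE X. is_pinv M X)"

definition leverage :: "real mat \<Rightarrow> real vec" where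
  "leverage B = vec (dim_row B)
     (\<lambda>i. row B i \<bullet> (pinv (transpose_mat B * B) *\<^sub>v row B i))"

definition positive_vec :: "nat \<Rightarrow> real vec \<Rightarrow> bool" where
  "positive_vec n u \<longleftrightarrow> u \<in> carrier_vec n \<and> (\<forall>i<n. 0 < u $ i)"

text \<open>\<open>reweight p u A\<close> is \<open>Diag(u)\<close> to the power \<open>1/2 - 1/p\<close>, times \<open>A\<close>.\<close>

definition reweight :: "real \<Rightarrow> real vec \<Rightarrow> real mat \<Rightarrow> real mat" where
  "reweight p u A = mat_diag (dim_row A) (\<lambda>i. (u $ i) powr (1/2 - 1/p)) * A"

text \<open>The order on vectors below is the entrywise one (it includes equality of dimensions).\<close>

definition approx_leverage ::
  "real \<Rightarrow> real \<Rightarrow> real mat \<Rightarrow> real vec \<Rightarrow> real vec \<Rightarrow> bool" where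
  "approx_leverage \<delta> p A u s \<longleftrightarrow>
     (1 - \<delta>) \<cdot>\<^sub>v leverage (reweight p u A) \<le> s \<and>
     s \<le> (1 + \<delta>) \<cdot>\<^sub>v leverage (reweight p u A)"

definition two_sided_lewis :: "real \<Rightarrow> real \<Rightarrow> real mat \<Rightarrow> real vec \<Rightarrow> bool" where
  "two_sided_lewis \<epsilon> p A w \<longleftrightarrow>
     positive_vec (dim_row A) w \<and>
     (1 - \<epsilon>) \<cdot>\<^sub>v leverage (reweight p w A) \<le> w \<and>
     w \<le> (1 + \<epsilon>) \<cdot>\<^sub>v leverage (reweight p w A)"


section \<open>Programs with oracle calls\<close>

text \<open>
  An algorithm is a finite computation tree over the reals with oracle nodes. It never sees the
  matrix: queries, branch conditions and the output are arithmetic terms in the entries of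
  the oracle answers received so far (\<open>Ans k i\<close> is entry \<open>i\<close> of the \<open>k\<close>-th answer, counting
  from 0). Terms are total: division by zero yields zero, and so do nonexistent entries.
\<close>

datatype rterm =
    Num real
  | Ans nat nat
  | Plus rterm rterm
  | Minus rterm rterm
  | Times rterm rterm
  | Divide rterm rterm
  | Power rterm rterm

primrec rterm_val :: "real vec list \<Rightarrow> rterm \<Rightarrow> real" where
  "rterm_val h (Num x) = x"
| "rterm_val h (Ans k i) = (if k < length h \<and> i < dim_vec (h ! k) then h ! k $ i else 0)"
| "rterm_val h (Plus s t) = rterm_val h s + rterm_val h t"
| "rterm_val h (Minus s t) = rterm_val h s - rterm_val h t"
| "rterm_val h (Times s t) = rterm_val h s * rterm_val h t"
| "rterm_val h (Divide s t) = rterm_val h s / rterm_val h t"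
| "rterm_val h (Power s t) = rterm_val h s powr rterm_val h t"

definition rterms_vec :: "real vec list \<Rightarrow> rterm list \<Rightarrow> real vec" where
  "rterms_vec h ts = vec_of_list (map (rterm_val h) ts)"

datatype oracle_prog =
    Output "rterm list"
  | Branch rterm oracle_prog oracle_prog
  | Query "rterm list" oracle_prog

text \<open>The worst-case number of oracle calls:\<close>

primrec num_queries :: "oracle_prog \<Rightarrow> nat" where
  "num_queries (Output ts) = 0"
| "num_queries (Branch t P Q) = max (num_queries P) (num_queries Q)"
| "num_queries (Query ts P) = Suc (num_queries P)"

text \<open>
  \<open>computes valid answer goal P h\<close>: started with the answers \<open>h\<close>, the program \<open>P\<close> issues only
  \<open>valid\<close> queries and its output satisfies \<open>goal\<close>, no matter which of the admissible answers
  (\<open>answer u s\<close> means that \<open>s\<close> is an admissible answer to the query \<open>u\<close>) the oracle gives,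
  adversarially and adaptively.
\<close>

primrec computes ::
  "(real vec \<Rightarrow> bool) \<Rightarrow> (real vec \<Rightarrow> real vec \<Rightarrow> bool) \<Rightarrow> (real vec \<Rightarrow> bool)
     \<Rightarrow> oracle_prog \<Rightarrow> real vec list \<Rightarrow> bool" where
  "computes valid answer goal (Output ts) h = goal (rterms_vec h ts)"
| "computes valid answer goal (Branch t P Q) h =
     (if rterm_val h t > 0 then computes valid answer goal P h
      else computes valid answer goal Q h)"
| "computes valid answer goal (Query ts P) h =
     (valid (rterms_vec h ts) \<and>
      (\<forall>s. answer (rterms_vec h ts) s \<longrightarrow> computes valid answer goal P (h @ [s])))"

end

theory Submission
  imports Defs "Jordan_Normal_Form.Gauss_Jordan_Elimination"
begin

text \<open>
  Write \<open>a\<^sub>i\<close> for the rows of \<open>A\<close>, \<open>\<sigma>(w)\<close> for the leverage scores of the matrix reweighted by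
  \<open>w\<close>, and \<open>Q\<^sub>w(x) = (\<Sum>j. w\<^sub>j powr (1 - 2/p) * (a\<^sub>j \<bullet> x)\<^sup>2)\<close>. Then \<open>w\<^sub>i powr (1 - 2/p) / \<sigma>\<^sub>i(w)\<close> is
  the minimum of \<open>Q\<^sub>w(x)\<close> over \<open>a\<^sub>i \<bullet> x = 1\<close>, so it is concave in \<open>w\<close>, and hence so is
  \<open>ln (w\<^sub>i / \<sigma>\<^sub>i(w))\<close>. Along the iteration \<open>w \<mapsto> \<sigma>(w)\<close>, started at \<open>d/n\<close>, these logarithms telescope;
  by concavity the mean \<open>v\<close> of \<open>T\<close> iterates satisfies \<open>\<sigma>(v) \<le> (1 + O(ln (2 + n/d) / T)) v\<close>. Its total
  mass is close to the rank of \<open>A\<close>, which is the sum of all leverage scores. After a slight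
  rescaling to \<open>u \<ge> \<sigma>(u)\<close>, the output \<open>w\<^sub>i = u\<^sub>i (\<sigma>\<^sub>i(u) / u\<^sub>i) powr (p/2)\<close> is chosen such that
  \<open>w\<^sub>i powr (2/p) = \<sigma>\<^sub>i(u) / u\<^sub>i powr (1 - 2/p)\<close>. It is a two-sided approximation as soon as \<open>Q\<^sub>w\<close> is close
  to \<open>Q\<^sub>u\<close>, and Bernoulli's inequality bounds their relative difference by
  \<open>(p/2 - 1) * (\<Sum>i. u\<^sub>i - \<sigma>\<^sub>i(u))\<close>.
\<close>

section \<open>The pseudoinverse of a symmetric matrix\<close>

text \<open>Pivot columns of a reduced echelon form are unit vectors, so the 0/1 matrix
  \<open>H\<close> makes \<open>C * H\<close> the diagonal projector onto the nonzero rows. The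
  pivot index \<open>nc\<close> marks a zero row; its column in \<open>H\<close> is zero.\<close>

lemma ex_generalized_inverse_row_echelon:
  fixes C :: "'a :: field mat"
  assumes C: "C \<in> carrier_mat nr nc" and ech: "row_echelon_form C"
  shows "\<exists>H \<in> carrier_mat nc nr. C * H * C = C"
proof -
  obtain f where f: "pivot_fun C f nc"
    using ech C unfolding row_echelon_form_def by auto
  have dim: "dim_row C = nr" using C by auto
  note piv = pivot_funD[OF dim f]
  define H where "H = mat nc nr (\<lambda>(l, k). if l = f k then 1 else 0 :: 'a)"
  have H: "H \<in> carrier_mat nc nr" unfolding H_def by auto
  define E where "E = C * H"
  have E: "E \<in> carrier_mat nr nr" unfolding E_def using C H by auto
  have CH: "E $$ (i, k) = (if i = k \<and> f i < nc then 1 else 0)" if i: "i < nr" and k: "k < nr" for i k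
  proof -
    have "E $$ (i, k) = (\<Sum>l<nc. C $$ (i, l) * (if l = f k then 1 else 0))"
      using C i k unfolding E_def H_def by (auto simp: scalar_prod_def atLeast0LessThan)
    also have "\<dots> = (if f k < nc then C $$ (i, f k) else 0)"
      by (simp add: if_distrib[of "\<lambda>x. _ * x"] cong: if_cong)
    also have "\<dots> = (if i = k \<and> f i < nc then 1 else 0)"
      using piv(4)[OF k] piv(5)[OF k _ i] by auto
    finally show ?thesis .
  qed
  have "E * C = C"
  proof (rule eq_matI)
    fix i j assume i: "i < dim_row C" and j: "j < dim_col C"
    have i': "i < nr" and j': "j < nc" using i j C by auto
    have "(E * C) $$ (i, j) = (\<Sum>k<nr. E $$ (i, k) * C $$ (k, j))"
      using E C i' j' by (simp add: scalar_prod_def atLeast0LessThan)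
    also have "\<dots> = (\<Sum>k<nr. if k = i then (if f i < nc then C $$ (i, j) else 0) else 0)"
      using i' by (intro sum.cong) (simp_all add: CH)
    also have "\<dots> = (if f i < nc then C $$ (i, j) else 0)" using i' by simp
    also have "\<dots> = C $$ (i, j)"
      using piv(1)[OF i'] piv(2)[OF i', of j] j' by auto
    finally show "(E * C) $$ (i, j) = C $$ (i, j)" .
  qed (use C E in auto)
  with H show ?thesis unfolding E_def by blast
qed

text \<open>Row reduction writes \<open>M = Q * C\<close> with \<open>Q\<close> inverse to
  \<open>P\<close>, so a generalized inverse \<open>H\<close> of the echelon form yields
  \<open>H * P\<close> for \<open>M\<close>.\<close>

lemma ex_generalized_inverse:
  fixes M :: "'a :: field mat"
  assumes M: "M \<in> carrier_mat nr nc"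
  shows "\<exists>G \<in> carrier_mat nc nr. M * G * M = M"
proof -
  define C where "C = gauss_jordan_single M"
  note gj = gauss_jordan_single[OF M C_def[symmetric]]
  obtain P Q where PQ: "C = P * M" "P \<in> carrier_mat nr nr" "Q \<in> carrier_mat nr nr" "Q * P = 1\<^sub>m nr"
    using gj(4) by blast
  obtain H where H: "H \<in> carrier_mat nc nr" and CHC: "C * H * C = C"
    using ex_generalized_inverse_row_echelon[OF gj(2,3)] by blast
  have QC: "Q * C = M"
    using PQ M by (simp add: assoc_mult_mat[of Q nr nr P nr M nc, symmetric])
  have HC: "H * C \<in> carrier_mat nc nc" using H gj(2) by auto
  have "M * (H * P) * M = M * (H * P * M)"
    using M H PQ by (intro assoc_mult_mat) auto
  also have "H * P * M = H * C"
    using M H PQ by (simp add: assoc_mult_mat[of _ nc nr _ nr])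
  also have "M * (H * C) = Q * C * (H * C)" using QC by simp
  also have "\<dots> = Q * (C * (H * C))"
    by (rule assoc_mult_mat[OF PQ(3) gj(2) HC])
  also have "\<dots> = Q * C"
    using CHC assoc_mult_mat[OF gj(2) H gj(2)] by simp
  finally show ?thesis using QC H PQ(2) by (intro bexI[of _ "H * P"]) auto
qed

text \<open>The difference \<open>Z\<close> lies in the column space of \<open>B\<close> and is
  annihilated by the transpose of \<open>B\<close>. Hence \<open>transpose_mat Z * Z\<close>
  vanishes, and over the reals so does \<open>Z\<close>.\<close>

lemma gram_cancel:
  fixes B :: "real mat"
  assumes B: "B \<in> carrier_mat n d" and Y: "Y \<in> carrier_mat d m" and Y': "Y' \<in> carrier_mat d m"
    and eq: "transpose_mat B * B * Y = transpose_mat B * B * Y'"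
  shows "B * Y = B * Y'"
proof -
  define Z where "Z = B * Y - B * Y'"
  have Z: "Z \<in> carrier_mat n m" using B Y Y' unfolding Z_def by auto
  have "transpose_mat B * Z = transpose_mat B * (B * Y) - transpose_mat B * (B * Y')"
    unfolding Z_def using B Y Y' by (intro mult_minus_distrib_mat) auto
  also have "\<dots> = transpose_mat B * B * Y - transpose_mat B * B * Y'"
    using B Y Y' by (simp add: assoc_mult_mat[of _ d n])
  also have "\<dots> = 0\<^sub>m d m" unfolding eq using B Y' by auto
  finally have BZ: "transpose_mat B * Z = 0\<^sub>m d m" .
  have "Z = B * (Y - Y')"
    unfolding Z_def using B Y Y' by (intro mult_minus_distrib_mat[symmetric]) auto
  then have "transpose_mat Z * Z = transpose_mat (Y - Y') * transpose_mat B * Z"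
    using transpose_mult[OF B minus_carrier_mat[OF Y', of Y]] by simp
  also have "\<dots> = transpose_mat (Y - Y') * (transpose_mat B * Z)"
    using B Y Y' Z by (intro assoc_mult_mat) auto
  also have "\<dots> = 0\<^sub>m m m" unfolding BZ using Y Y' by auto
  finally have ZZ: "transpose_mat Z * Z = 0\<^sub>m m m" .
  have "Z $$ (i, j) = 0" if i: "i < n" and j: "j < m" for i j
  proof -
    have "(\<Sum>k<n. (Z $$ (k, j))\<^sup>2) = (transpose_mat Z * Z) $$ (j, j)"
      using Z j by (auto simp: scalar_prod_def atLeast0LessThan power2_eq_square)
    also have "\<dots> = 0" using ZZ j by auto
    finally show ?thesis using i by (simp add: sum_nonneg_eq_0_iff)
  qed
  then have "(B * Y) $$ (i, j) = (B * Y') $$ (i, j)" if "i < n" "j < m" for i j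
    using that B Y Y' unfolding Z_def by auto
  then show ?thesis using B Y Y' by (intro eq_matI) auto
qed

text \<open>A generalized inverse \<open>G\<close> of \<open>M * M\<close>, rather than of
  \<open>M\<close>, allows cancelling by \<open>gram_cancel\<close>: \<open>M G M M = M\<close> and,
  via the transpose of \<open>G\<close>, \<open>M M G M = M\<close>. Then
  \<open>X = M G M G M\<close> works, because \<open>M * X\<close> and \<open>X * M\<close> both
  collapse to \<open>M G M\<close>.\<close>

lemma ex_is_pinv_symmetric:
  fixes M :: "real mat"
  assumes M: "M \<in> carrier_mat d d" and sym: "transpose_mat M = M"
  shows "\<exists>X. is_pinv M X"
proof -
  note assoc = assoc_mult_mat[of _ d d _ d _ d]
  note carr = mult_carrier_mat[of _ d d _ d]
  obtain G where G: "G \<in> carrier_mat d d" and GN: "M * M * G * (M * M) = M * M"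
    using ex_generalized_inverse[of "M * M" d d] M by auto
  have cancel: "M * (K * (M * M)) = M" 
    if K: "K \<in> carrier_mat d d" and KN: "M * M * K * (M * M) = M * M" for K
  proof -
    have "transpose_mat M * M * (K * (M * M)) = transpose_mat M * M * 1\<^sub>m d"
      using KN K M unfolding sym by (simp add: assoc carr)
    from gram_cancel[OF M _ one_carrier_mat this] show ?thesis using M K by (simp add: carr)
  qed
  define G' where "G' = transpose_mat G"
  have G': "G' \<in> carrier_mat d d" unfolding G'_def using G by auto
  have G'N: "M * M * G' * (M * M) = M * M"
  proof -
    have "M * M = transpose_mat (M * M * G * (M * M))"
      unfolding GN using M sym by (simp add: transpose_mult[of _ d d _ d])
    also have "\<dots> = M * M * G' * (M * M)"
      using M G G' sym unfolding G'_def by (simp add: transpose_mult[of _ d d _ d] assoc carr)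
    finally show ?thesis by simp
  qed
  have a: "M * (G * (M * M)) = M" by (rule cancel[OF G GN])
  have b': "M * (G' * (M * M)) = M" by (rule cancel[OF G' G'N])
  have b: "M * (M * (G * M)) = M"
  proof -
    have "transpose_mat (M * (G' * (M * M))) = M * (M * (G * M))"
      using M G G' sym unfolding G'_def by (simp add: transpose_mult[of _ d d _ d] assoc carr)
    then show ?thesis using b' sym by simp
  qed
  have b2: "M * (M * (G * (M * Y))) = M * Y" if "Y \<in> carrier_mat d d" for Y
    using arg_cong[OF b, of "\<lambda>Z. Z * Y"] M G that by (simp add: assoc carr)
  have b'2: "M * (G' * (M * (M * Y))) = M * Y" if "Y \<in> carrier_mat d d" for Y
    using arg_cong[OF b', of "\<lambda>Z. Z * Y"] M G' that by (simp add: assoc carr)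
  \<comment> \<open>This yields the symmetry of \<open>M G M\<close> required by the last two
    Penrose equations; \<open>G\<close> itself need not be symmetric.\<close>
  have symMGM: "M * (G' * M) = M * (G * M)"
    using b'2[of "G * M"] b M G G' by (simp add: carr)
  define X where "X = M * (G * (M * (G * M)))"
  have X: "X \<in> carrier_mat d d" unfolding X_def using M G by (simp add: carr)
  have MX: "M * X = M * (G * M)" unfolding X_def using b2[of "G * M"] M G by (simp add: carr)
  have XM: "X * M = M * (G * M)" unfolding X_def using a M G by (simp add: assoc carr)
  have t: "transpose_mat (M * (G * M)) = M * (G * M)"
    using M G sym symMGM unfolding G'_def by (simp add: transpose_mult[of _ d d _ d] assoc carr)
  have "M * X * M = M" unfolding MX using a M G by (simp add: assoc carr)
  moreover have "X * M * X = X"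
    unfolding XM using MX M G X by (simp add: assoc carr) (simp add: X_def)
  ultimately have "is_pinv M X" unfolding is_pinv_def using M X MX XM t by auto
  then show ?thesis by blast
qed

text \<open>\<open>M * X\<close> and \<open>M * Y\<close> absorb each other; being symmetric, they
  coincide by transposition. The same holds for \<open>X * M\<close> and \<open>Y * M\<close>, so
  \<open>X = X * (M * Y) = (Y * M) * Y = Y\<close>.\<close>

lemma is_pinv_unique:
  fixes M :: "real mat"
  assumes M: "M \<in> carrier_mat d d" and PX: "is_pinv M X" and PY: "is_pinv M Y"
  shows "X = Y"
proof -
  note assoc = assoc_mult_mat[of _ d d _ d _ d]
  note carr = mult_carrier_mat[of _ d d _ d]
  note tr = transpose_mult[of _ d d _ d]
  have X: "X \<in> carrier_mat d d" "M * X * M = M" "X * M * X = X"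
    "transpose_mat (M * X) = M * X" "transpose_mat (X * M) = X * M"
    using PX M unfolding is_pinv_def by auto
  have Y: "Y \<in> carrier_mat d d" "M * Y * M = M" "Y * M * Y = Y"
    "transpose_mat (M * Y) = M * Y" "transpose_mat (Y * M) = Y * M"
    using PY M unfolding is_pinv_def by auto
  have MXc: "M * X \<in> carrier_mat d d" "M * Y \<in> carrier_mat d d" "X * M \<in> carrier_mat d d" "Y * M \<in> carrier_mat d d"
    using M X Y by (auto simp: carr)
  have absorb: "(M * K) * (M * L) = M * L" "(L * M) * (K * M) = L * M"
    if "K \<in> carrier_mat d d" "L \<in> carrier_mat d d" "M * K * M = M" for K L
  proof -
    have "(M * K) * (M * L) = (M * K * M) * L" "(L * M) * (K * M) = L * (M * K * M)"
      using M that(1,2) by (simp_all add: assoc carr)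
    then show "(M * K) * (M * L) = M * L" "(L * M) * (K * M) = L * M" unfolding that(3) by auto
  qed
  have "M * X = (M * Y) * (M * X)"
    using absorb[OF Y(1) X(1) Y(2)] by simp
  also have "\<dots> = transpose_mat ((M * X) * (M * Y))"
    using MXc X Y by (simp add: tr)
  also have "(M * X) * (M * Y) = M * Y"
    by (rule absorb[OF X(1) Y(1) X(2)])
  finally have 1: "M * X = M * Y" using Y by simp
  have "X * M = (X * M) * (Y * M)"
    using absorb[OF Y(1) X(1) Y(2)] by simp
  also have "\<dots> = transpose_mat ((Y * M) * (X * M))"
    using MXc X Y by (simp add: tr)
  also have "(Y * M) * (X * M) = Y * M"
    by (rule absorb[OF X(1) Y(1) X(2)])
  finally have 2: "X * M = Y * M" using Y by simp
  have "X = X * (M * X)" using X M by (simp add: assoc carr)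
  also have "\<dots> = X * M * Y" unfolding 1 using X Y M by (simp add: assoc carr)
  also have "\<dots> = Y" unfolding 2 using Y by simp
  finally show ?thesis .
qed

text \<open>The transpose of \<open>pinv M\<close> solves the Penrose equations of \<open>M\<close>
  as well, so uniqueness gives the symmetry.\<close>

lemma pinv_symmetric:
  fixes M :: "real mat"
  assumes M: "M \<in> carrier_mat d d" and sym: "transpose_mat M = M"
  shows "is_pinv M (pinv M)" and "transpose_mat (pinv M) = pinv M"
proof -
  obtain X where X: "is_pinv M X" using ex_is_pinv_symmetric[OF M sym] by blast
  show P: "is_pinv M (pinv M)"
    unfolding pinv_def by (rule theI[of "is_pinv M", OF X]) (rule is_pinv_unique[OF M _ X])
  note tr = transpose_mult[of _ d d _ d]
  have p: "pinv M \<in> carrier_mat d d" using P M unfolding is_pinv_def by auto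
  have *: "transpose_mat (M * K * M) = M * transpose_mat K * M" "transpose_mat (K * M * K) = transpose_mat K * M * transpose_mat K"
    "transpose_mat (M * K) = transpose_mat K * M" "transpose_mat (K * M) = M * transpose_mat K"
    if "K \<in> carrier_mat d d" for K
    using that M sym by (simp_all add: tr mult_carrier_mat[of _ d d _ d] assoc_mult_mat[of _ d d _ d _ d])
  have X: "M * pinv M * M = M" "pinv M * M * pinv M = pinv M"
    "transpose_mat (M * pinv M) = M * pinv M" "transpose_mat (pinv M * M) = pinv M * M"
    using P unfolding is_pinv_def by auto
  have "M * transpose_mat (pinv M) * M = M"
    using *(1)[OF p] unfolding X sym by simp
  moreover have "transpose_mat (pinv M) * M * transpose_mat (pinv M) = transpose_mat (pinv M)"
    using *(2)[OF p] unfolding X by simp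
  moreover have "M * transpose_mat (pinv M) = pinv M * M" "transpose_mat (pinv M) * M = M * pinv M"
    using *(3,4)[OF p] unfolding X by simp_all
  ultimately have "is_pinv M (transpose_mat (pinv M))"
    unfolding is_pinv_def using X M p by simp
  from is_pinv_unique[OF M this P] show "transpose_mat (pinv M) = pinv M" .
qed

section \<open>Leverage scores\<close>

lemma sum_mult_sq_le:
  fixes f g :: "'a \<Rightarrow> real"
  assumes "finite I"
  shows "(\<Sum>i\<in>I. f i * g i)\<^sup>2 \<le> (\<Sum>i\<in>I. (f i)\<^sup>2) * (\<Sum>i\<in>I. (g i)\<^sup>2)"
proof -
  define S c R where "S = (\<Sum>i\<in>I. (f i)\<^sup>2)" and "c = (\<Sum>i\<in>I. f i * g i)" and "R = (\<Sum>i\<in>I. (g i)\<^sup>2)"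
  \<comment> \<open>Expanding the squared norm of \<open>S * g - c * f\<close> leaves
    \<open>S\<close> times the Cauchy-Schwarz gap, so only \<open>S = 0\<close> needs a separate
    argument.\<close>
  have "0 \<le> (\<Sum>i\<in>I. (S * g i - c * f i)\<^sup>2)" by (intro sum_nonneg) auto
  also have "\<dots> = (\<Sum>i\<in>I. S\<^sup>2 * (g i)\<^sup>2 - 2 * S * c * (f i * g i) + c\<^sup>2 * (f i)\<^sup>2)"
    by (intro sum.cong) (auto simp: power2_eq_square algebra_simps)
  also have "\<dots> = S\<^sup>2 * R - 2 * S * c * c + c\<^sup>2 * S"
    unfolding R_def by (simp add: sum.distrib sum_subtractf sum_distrib_left[symmetric] S_def[symmetric] c_def[symmetric])
  also have "\<dots> = S * (S * R - c\<^sup>2)" by (simp add: power2_eq_square algebra_simps)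
  finally have *: "0 \<le> S * (S * R - c\<^sup>2)" .
  have "S \<ge> 0" unfolding S_def by (intro sum_nonneg) auto
  then show ?thesis
  proof (cases "S = 0")
    case True
    then have "\<forall>i\<in>I. f i = 0" using assms unfolding S_def by (simp add: sum_nonneg_eq_0_iff)
    then show ?thesis by simp
  next
    case False
    with \<open>S \<ge> 0\<close> * have "0 \<le> S * R - c\<^sup>2" by (simp add: zero_le_mult_iff)
    then show ?thesis unfolding S_def R_def c_def by simp
  qed
qed

text \<open>\<open>X * (transpose_mat B * B)\<close> is the orthogonal projector onto the row space
  of \<open>B\<close>. That it fixes the rows of \<open>B\<close> is the first Penrose equation with
  a transposed \<open>B\<close> cancelled.\<close>

lemma leverage_gram:
  fixes B :: "real mat"
  assumes B: "B \<in> carrier_mat n d"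
  defines "X \<equiv> pinv (transpose_mat B * B)"
  shows "X \<in> carrier_mat d d" and "transpose_mat X = X" and "B * (X * (transpose_mat B * B)) = B"
    and "transpose_mat (X * (transpose_mat B * B)) = X * (transpose_mat B * B)"
proof -
  have M: "transpose_mat B * B \<in> carrier_mat d d" using B by auto
  have sym: "transpose_mat (transpose_mat B * B) = transpose_mat B * B"
    using transpose_mult[of "transpose_mat B" d n B d] B by simp
  note P = pinv_symmetric[OF M sym]
  show X: "X \<in> carrier_mat d d" using P(1) M unfolding is_pinv_def X_def by auto
  show "transpose_mat X = X" unfolding X_def by (rule P(2))
  show "transpose_mat (X * (transpose_mat B * B)) = X * (transpose_mat B * B)"
    using P(1) unfolding is_pinv_def X_def by auto
  have "transpose_mat B * B * (X * (transpose_mat B * B)) = transpose_mat B * B * X * (transpose_mat B * B)"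
    using M X by (intro assoc_mult_mat[symmetric]) auto
  also have "\<dots> = transpose_mat B * B * 1\<^sub>m d"
    using P(1) M unfolding is_pinv_def X_def by auto
  finally show "B * (X * (transpose_mat B * B)) = B"
    using gram_cancel[OF B _ one_carrier_mat] X M B by (metis mult_carrier_mat right_mult_one_mat)
qed

text \<open>Inserting the projector and moving the symmetric \<open>X\<close> across the scalar
  product represents \<open>row B i\<close> by a vector in the column space of \<open>B\<close>, to
  which Cauchy-Schwarz applies.\<close>

lemma row_inner_eq_gram:
  fixes B :: "real mat"
  assumes B: "B \<in> carrier_mat n d" and i: "i < n" and x: "x \<in> carrier_vec d"
  shows "row B i \<bullet> x = (B *\<^sub>v (pinv (transpose_mat B * B) *\<^sub>v row B i)) \<bullet> (B *\<^sub>v x)"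
proof -
  define X where "X = pinv (transpose_mat B * B)"
  define M where "M = transpose_mat B * B"
  note X = leverage_gram[OF B, folded X_def M_def]
  have M: "M \<in> carrier_mat d d" using B unfolding M_def by auto
  have b: "row B i \<in> carrier_vec d" using B i by auto
  have Bx: "B *\<^sub>v x \<in> carrier_vec n" using B x by auto
  have Mx: "M *\<^sub>v x \<in> carrier_vec d" using M x by auto
  have "B *\<^sub>v x = (B * (X * M)) *\<^sub>v x" using X by simp
  also have "\<dots> = B *\<^sub>v (X *\<^sub>v (M *\<^sub>v x))"
    using B X(1) M x by (simp add: assoc_mult_mat_vec[of _ n d _ d] assoc_mult_mat_vec[of _ d d _ d])
  finally have "(B *\<^sub>v x) $ i = (B *\<^sub>v (X *\<^sub>v (M *\<^sub>v x))) $ i" by simp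
  then have "row B i \<bullet> x = row B i \<bullet> (X *\<^sub>v (M *\<^sub>v x))" using B i by simp
  also have "\<dots> = (X *\<^sub>v row B i) \<bullet> (M *\<^sub>v x)"
    using transpose_vec_mult_scalar[OF X(1) Mx b] X(2) by simp
  also have "\<dots> = (M *\<^sub>v x) \<bullet> (X *\<^sub>v row B i)"
    using X(1) Mx b by (intro comm_scalar_prod[of _ d]) auto
  also have "M *\<^sub>v x = transpose_mat B *\<^sub>v (B *\<^sub>v x)"
    unfolding M_def using B x by (intro assoc_mult_mat_vec) auto
  also have "\<dots> \<bullet> (X *\<^sub>v row B i) = (B *\<^sub>v x) \<bullet> (B *\<^sub>v (X *\<^sub>v row B i))"
    using transpose_vec_mult_scalar[OF B _ Bx] X(1) b by auto
  also have "\<dots> = (B *\<^sub>v (X *\<^sub>v row B i)) \<bullet> (B *\<^sub>v x)"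
    using B X(1) b x by (intro comm_scalar_prod[of _ n]) auto
  finally show ?thesis unfolding X_def .
qed

lemma scalar_prod_mult_mat_vec_self:
  fixes B :: "real mat"
  assumes "B \<in> carrier_mat n d"
  shows "(B *\<^sub>v x) \<bullet> (B *\<^sub>v x) = (\<Sum>j<n. (row B j \<bullet> x)\<^sup>2)"
  using assms by (auto simp: scalar_prod_def[of "B *\<^sub>v x"] atLeast0LessThan power2_eq_square)

text \<open>Cauchy-Schwarz with the representing vector, whose squared norm is the score
  itself.\<close>

lemma leverage_variational_bound:
  fixes B :: "real mat"
  assumes B: "B \<in> carrier_mat n d" and i: "i < n" and x: "x \<in> carrier_vec d"
  shows "(row B i \<bullet> x)\<^sup>2 \<le> leverage B $ i * (\<Sum>j<n. (row B j \<bullet> x)\<^sup>2)"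
    and "leverage B $ i = (\<Sum>j<n. (row B j \<bullet> (pinv (transpose_mat B * B) *\<^sub>v row B i))\<^sup>2)"
proof -
  let ?y = "pinv (transpose_mat B * B) *\<^sub>v row B i"
  have y: "?y \<in> carrier_vec d" using leverage_gram(1)[OF B] B i by auto
  have "leverage B $ i = row B i \<bullet> ?y" unfolding leverage_def using B i by auto
  also have "\<dots> = (\<Sum>j<n. (row B j \<bullet> ?y)\<^sup>2)"
    unfolding row_inner_eq_gram[OF B i y] by (rule scalar_prod_mult_mat_vec_self[OF B])
  finally show lev: "leverage B $ i = (\<Sum>j<n. (row B j \<bullet> ?y)\<^sup>2)" .
  have "row B i \<bullet> x = (\<Sum>j<n. (row B j \<bullet> ?y) * (row B j \<bullet> x))"
    unfolding row_inner_eq_gram[OF B i x] using B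
    by (auto simp: scalar_prod_def[of "B *\<^sub>v _"] atLeast0LessThan)
  then show "(row B i \<bullet> x)\<^sup>2 \<le> leverage B $ i * (\<Sum>j<n. (row B j \<bullet> x)\<^sup>2)"
    unfolding lev by (simp add: sum_mult_sq_le)
qed

text \<open>The equality case of the bound above; such an extremal \<open>x\<close> later carries
  estimates from one weight vector to another.\<close>

lemma leverage_variational_attained:
  fixes B :: "real mat"
  assumes B: "B \<in> carrier_mat n d" and i: "i < n"
  obtains x where "x \<in> carrier_vec d" and "row B i \<bullet> x = leverage B $ i"
    and "(\<Sum>j<n. (row B j \<bullet> x)\<^sup>2) = leverage B $ i"
proof
  let ?y = "pinv (transpose_mat B * B) *\<^sub>v row B i"
  show y: "?y \<in> carrier_vec d" using leverage_gram(1)[OF B] B i by auto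
  show "row B i \<bullet> ?y = leverage B $ i" unfolding leverage_def using B i by auto
  show "(\<Sum>j<n. (row B j \<bullet> ?y)\<^sup>2) = leverage B $ i"
    using leverage_variational_bound(2)[OF B i y] by simp
qed

section \<open>The total of the scores\<close>

lemma sum_leverage_eq_trace:
  fixes B :: "real mat"
  assumes B: "B \<in> carrier_mat n d"
  shows "(\<Sum>i<n. leverage B $ i) = (\<Sum>j<d. (pinv (transpose_mat B * B) * (transpose_mat B * B)) $$ (j, j))"
proof -
  define X where "X = pinv (transpose_mat B * B)"
  note X = leverage_gram(1)[OF B, folded X_def]
  have "(\<Sum>i<n. leverage B $ i) = (\<Sum>i<n. \<Sum>j<d. \<Sum>k<d. B $$ (i, j) * (X $$ (j, k) * B $$ (i, k)))"
    unfolding leverage_def X_def[symmetric] using B X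
    by (auto simp: scalar_prod_def atLeast0LessThan sum_distrib_left intro!: sum.cong)
  also have "\<dots> = (\<Sum>j<d. \<Sum>i<n. \<Sum>k<d. B $$ (i, j) * (X $$ (j, k) * B $$ (i, k)))"
    by (rule sum.swap)
  also have "\<dots> = (\<Sum>j<d. \<Sum>k<d. \<Sum>i<n. B $$ (i, j) * (X $$ (j, k) * B $$ (i, k)))"
    by (intro sum.cong refl sum.swap)
  also have "\<dots> = (\<Sum>j<d. (X * (transpose_mat B * B)) $$ (j, j))"
    using B X by (auto simp: scalar_prod_def atLeast0LessThan sum_distrib_left algebra_simps intro!: sum.cong)
  finally show ?thesis unfolding X_def .
qed

text \<open>\<open>P\<close> is a symmetric idempotent, so \<open>P $$ (j, j)\<close> is the sum of
  the squares of row \<open>j\<close> and dominates its own square. Hence each of the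
  \<open>d\<close> diagonal entries is at most 1.\<close>

lemma sum_leverage_le:
  fixes B :: "real mat"
  assumes B: "B \<in> carrier_mat n d"
  shows "(\<Sum>i<n. leverage B $ i) \<le> real d"
proof -
  define X where "X = pinv (transpose_mat B * B)"
  define M where "M = transpose_mat B * B"
  define P where "P = X * M"
  note X = leverage_gram[OF B, folded X_def M_def]
  have M: "M \<in> carrier_mat d d" using B unfolding M_def by auto
  have P: "P \<in> carrier_mat d d" using X(1) M unfolding P_def by auto
  have "M * P = transpose_mat B * (B * P)"
    unfolding M_def using B P by (intro assoc_mult_mat) auto
  then have "M * P = M" using X(3) unfolding P_def M_def by simp
  then have PP: "P * P = P"
    using assoc_mult_mat[OF X(1) M P] unfolding P_def by simp
  have sym: "P $$ (j, k) = P $$ (k, j)" if "j < d" "k < d" for j k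
    using X(4) P that unfolding P_def[symmetric] by (metis carrier_matD index_transpose_mat(1))
  have "P $$ (j, j) \<le> 1" if j: "j < d" for j
  proof -
    have "P $$ (j, j) = (P * P) $$ (j, j)" unfolding PP ..
    also have "\<dots> = (\<Sum>k<d. P $$ (j, k) * P $$ (k, j))"
      using P j by (auto simp: scalar_prod_def atLeast0LessThan)
    also have "\<dots> = (\<Sum>k<d. (P $$ (j, k))\<^sup>2)"
      using sym[OF j] by (intro sum.cong) (auto simp: power2_eq_square)
    also have "\<dots> \<ge> (P $$ (j, j))\<^sup>2"
      using j by (intro member_le_sum) auto
    finally show ?thesis 
      by (cases "P $$ (j, j) > 0") (auto simp: power2_eq_square)
  qed
  then have "(\<Sum>j<d. P $$ (j, j)) \<le> (\<Sum>j<d. 1)" by (intro sum_mono) auto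
  then show ?thesis using sum_leverage_eq_trace[OF B] unfolding P_def X_def M_def by simp
qed

text \<open>The sum is the trace of the orthogonal projection onto the row space, so it depends only on
  that space.\<close>

lemma sum_leverage_cong:
  fixes B B' :: "real mat"
  assumes B: "B \<in> carrier_mat n d" and B': "B' \<in> carrier_mat n d"
    and D: "D \<in> carrier_mat n n" "B' = D * B" and D': "D' \<in> carrier_mat n n" "B = D' * B'"
  shows "(\<Sum>i<n. leverage B $ i) = (\<Sum>i<n. leverage B' $ i)"
proof -
  define P where "P = (\<lambda>B. pinv (transpose_mat B * B) * (transpose_mat B * B :: real mat))"
  \<comment> \<open>The rows of \<open>C\<close> lie in the row space of \<open>B\<close>, on which
    \<open>P B\<close> acts as the identity. Using this in both directions, with one transposition,
    gives \<open>P B = P B'\<close>.\<close>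
  have absorb: "P C * P B = P C" if B: "B \<in> carrier_mat n d" and C: "C \<in> carrier_mat n d"
    and D: "D \<in> carrier_mat n n" "C = D * B" for B C D
  proof -
    define X where "X = pinv (transpose_mat C * C)"
    have X: "X \<in> carrier_mat d d" using leverage_gram(1)[OF C] unfolding X_def .
    have PB: "P B \<in> carrier_mat d d" "B * P B = B"
      using leverage_gram(1,3)[OF B] B unfolding P_def by auto
    have "C * P B = D * (B * P B)"
      unfolding D(2) using D(1) B PB(1) by (intro assoc_mult_mat) auto
    then have CP: "C * P B = C" using PB(2) D(2) by simp
    have "P C * P B = X * (transpose_mat C * C * P B)"
      unfolding P_def X_def[symmetric] using X C PB(1) unfolding P_def by (intro assoc_mult_mat) auto
    also have "transpose_mat C * C * P B = transpose_mat C * (C * P B)"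
      using C PB(1) by (intro assoc_mult_mat) auto
    finally show ?thesis unfolding CP by (simp add: P_def X_def)
  qed
  have P: "P B \<in> carrier_mat d d" "transpose_mat (P B) = P B" if "B \<in> carrier_mat n d" for B
    using leverage_gram(1,4)[OF that] that unfolding P_def by auto
  have "P B = transpose_mat (P B * P B')"
    using absorb[OF B' B D'] P(2)[OF B] by simp
  also have "\<dots> = P B' * P B"
    using transpose_mult[OF P(1)[OF B] P(1)[OF B']] P(2)[OF B] P(2)[OF B'] by simp
  also have "\<dots> = P B'" by (rule absorb[OF B B' D])
  finally show ?thesis
    using sum_leverage_eq_trace[OF B] sum_leverage_eq_trace[OF B'] unfolding P_def by simp
qed

section \<open>Reweighted leverage scores\<close>

lemma powr_le_tangent:
  fixes a y :: real
  assumes "0 \<le> a" "a \<le> 1" "0 < y"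
  shows "y powr a \<le> 1 + a * (y - 1)"
proof -
  \<comment> \<open>Weighted AM-GM: \<open>m\<close> is the weighted mean of \<open>y\<close> and 1,
    and the bounds \<open>ln t \<le> t - 1\<close> at \<open>t = y / m\<close> and
    \<open>t = 1 / m\<close> have right sides that cancel after weighting.\<close>
  define m where "m = a * y + (1 - a)"
  have m: "m > 0" unfolding m_def using assms by (cases "a = 0") (auto intro: add_pos_nonneg)
  have "a * ln (y / m) \<le> a * (y / m - 1)"
    using assms m by (intro mult_left_mono ln_le_minus_one) auto
  moreover have "(1 - a) * ln (1 / m) \<le> (1 - a) * (1 / m - 1)"
    using assms m by (intro mult_left_mono ln_le_minus_one) auto
  moreover have "a * (y / m - 1) + (1 - a) * (1 / m - 1) = 0"
  proof -
    have "a * (y / m - 1) + (1 - a) * (1 / m - 1) = (a * y + (1 - a)) / m - 1"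
      using m by (simp add: field_simps)
    then show ?thesis using m unfolding m_def[symmetric] by simp
  qed
  ultimately have "a * ln (y / m) + (1 - a) * ln (1 / m) \<le> 0" by linarith
  then have "a * ln y \<le> ln m" using assms m by (simp add: ln_div algebra_simps)
  then have "exp (a * ln y) \<le> m" using m by (metis exp_le_cancel_iff exp_ln)
  then show ?thesis using assms unfolding m_def powr_def by (simp add: algebra_simps)
qed

text \<open>Rearranged, this is Bernoulli's inequality for the exponent \<open>q + 1\<close>, read
  off from the tangent bound for the inverse exponent. The factor \<open>r\<close> covers
  \<open>0 < q < 1\<close>, where \<open>1 - r powr q \<le> q * (1 - r)\<close> fails for small
  \<open>r\<close>.\<close>

lemma mult_one_minus_powr_le:
  fixes q r :: real
  assumes "0 \<le> q" "0 < r"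
  shows "r * (1 - r powr q) \<le> q * (1 - r)"
proof -
  have "(r powr (q + 1)) powr (1 / (q + 1)) \<le> 1 + 1 / (q + 1) * (r powr (q + 1) - 1)"
    using assms by (intro powr_le_tangent) auto
  then have "r \<le> 1 + 1 / (q + 1) * (r powr (q + 1) - 1)"
    using assms by (simp add: powr_powr)
  then have "(q + 1) * r \<le> (q + 1) * (1 + 1 / (q + 1) * (r powr (q + 1) - 1))"
    using assms by (intro mult_left_mono) auto
  also have "\<dots> = q + r powr (q + 1)"
    using assms by (simp add: field_simps)
  also have "r powr (q + 1) = r * r powr q" using assms by (simp add: powr_add)
  finally show ?thesis by (simp add: algebra_simps)
qed

text \<open>Jensen for a concave power: the tangent is taken at the mean \<open>m\<close>, so the
  linear terms sum to zero.\<close>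

lemma sum_powr_le_mean:
  fixes f :: "nat \<Rightarrow> real"
  assumes T: "T > 0" and f: "\<And>k. k < T \<Longrightarrow> f k > 0" and a: "0 \<le> a" "a \<le> 1"
  shows "(\<Sum>k<T. f k powr a) \<le> real T * ((\<Sum>k<T. f k) / real T) powr a"
proof -
  define m where "m = (\<Sum>k<T. f k) / real T"
  have S: "(\<Sum>k<T. f k) > 0" using T f by (intro sum_pos) auto
  have m: "m > 0" unfolding m_def using S T by simp
  have "(\<Sum>k<T. f k powr a) = m powr a * (\<Sum>k<T. (f k / m) powr a)"
    unfolding sum_distrib_left using f m by (intro sum.cong) (auto simp: powr_divide order_less_imp_le)
  also have "\<dots> \<le> m powr a * (\<Sum>k<T. 1 + a * (f k / m - 1))"
    using f m a by (intro mult_left_mono sum_mono powr_le_tangent) auto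
  also have "(\<Sum>k<T. 1 + a * (f k / m - 1)) = real T + a * ((\<Sum>k<T. f k) / m - real T)"
    by (simp add: sum.distrib sum_distrib_left[symmetric] sum_subtractf sum_divide_distrib)
  also have "(\<Sum>k<T. f k) / m = real T" unfolding m_def using S T by simp
  finally show ?thesis unfolding m_def by (simp add: mult.commute)
qed

lemma sum_ln_le_mean:
  fixes f :: "nat \<Rightarrow> real"
  assumes T: "T > 0" and f: "\<And>k. k < T \<Longrightarrow> f k > 0"
  shows "(\<Sum>k<T. ln (f k)) \<le> real T * ln ((\<Sum>k<T. f k) / real T)"
proof -
  define m where "m = (\<Sum>k<T. f k) / real T"
  have S: "(\<Sum>k<T. f k) > 0" using T f by (intro sum_pos) auto
  have m: "m > 0" unfolding m_def using S T by simp
  have "(\<Sum>k<T. ln (f k)) = (\<Sum>k<T. ln m + ln (f k / m))"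
    using f m by (intro sum.cong) (auto simp: ln_div less_imp_neq[THEN not_sym])
  also have "\<dots> \<le> (\<Sum>k<T. ln m + (f k / m - 1))"
    using f m by (intro sum_mono add_left_mono ln_le_minus_one) auto
  also have "\<dots> = real T * ln m + ((\<Sum>k<T. f k) / m - real T)"
    by (simp add: sum.distrib sum_subtractf sum_divide_distrib)
  also have "(\<Sum>k<T. f k) / m = real T" unfolding m_def using S T by simp
  finally show ?thesis unfolding m_def by simp
qed

text \<open>Zero rows are excluded because their score is zero, and no positive entry of
  \<open>w\<close> is bounded by a multiple of zero.\<close>

locale nonzero_rows =
  fixes A :: "real mat" and n d :: nat and p :: real
  assumes A: "A \<in> carrier_mat n d"
    and row_nonzero: "\<And>i. i < n \<Longrightarrow> row A i \<noteq> 0\<^sub>v d"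
    and p: "p \<ge> 2"
begin

definition lev :: "real vec \<Rightarrow> nat \<Rightarrow> real" where
  "lev w i = leverage (reweight p w A) $ i"

text \<open>The squared norm of the reweighted matrix applied to \<open>x\<close>; squaring doubles
  the exponent \<open>1/2 - 1/p\<close>. As the result lies between 0 and 1, the form is concave in
  positive weights.\<close>

definition form :: "real vec \<Rightarrow> real vec \<Rightarrow> real" where
  "form w x = (\<Sum>j<n. (w $ j) powr (1 - 2 / p) * (row A j \<bullet> x)\<^sup>2)"

lemma exponent: "0 \<le> 1 - 2 / p" "1 - 2 / p \<le> 1"
  using p by (auto simp: field_simps)

lemma reweight_carrier: "reweight p w A \<in> carrier_mat n d"
  unfolding reweight_def using A by (auto intro!: mult_carrier_mat[of _ n n])

lemma row_reweight_scalar_prod: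
  assumes "i < n" "x \<in> carrier_vec d"
  shows "row (reweight p w A) i \<bullet> x = (w $ i) powr (1 / 2 - 1 / p) * (row A i \<bullet> x)"
  unfolding reweight_def using A assms mat_diag_mult_left[of A n d]
  by (auto simp: scalar_prod_def sum_distrib_left mult.assoc intro!: sum.cong)

lemma row_reweight_scalar_prod_sq:
  assumes "i < n" "x \<in> carrier_vec d"
  shows "(row (reweight p w A) i \<bullet> x)\<^sup>2 = (w $ i) powr (1 - 2 / p) * (row A i \<bullet> x)\<^sup>2"
proof -
  have "((w $ i) powr (1 / 2 - 1 / p))\<^sup>2 = (w $ i) powr (1 - 2 / p)"
    by (simp add: power2_eq_square powr_add[symmetric])
  then show ?thesis by (simp add: row_reweight_scalar_prod[OF assms] power_mult_distrib)
qed

lemma form_eq: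
  assumes "x \<in> carrier_vec d"
  shows "(\<Sum>j<n. (row (reweight p w A) j \<bullet> x)\<^sup>2) = form w x"
  unfolding form_def using assms by (intro sum.cong) (auto simp: row_reweight_scalar_prod_sq)

lemma form_nonneg: "form w x \<ge> 0"
  unfolding form_def by (intro sum_nonneg) auto

lemma lev_bound:
  assumes "i < n" "x \<in> carrier_vec d"
  shows "(w $ i) powr (1 - 2 / p) * (row A i \<bullet> x)\<^sup>2 \<le> lev w i * form w x"
  using leverage_variational_bound(1)[OF reweight_carrier assms, of w]
  unfolding lev_def form_eq[OF assms(2)] row_reweight_scalar_prod_sq[OF assms] .

text \<open>Tested at \<open>x = row A i\<close>, the left side of \<open>lev_bound\<close> is
  positive.\<close>

lemma lev_pos:
  assumes w: "positive_vec n w" and i: "i < n"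
  shows "lev w i > 0"
proof -
  have x: "row A i \<in> carrier_vec d" using A i by auto
  have "row A i \<bullet> row A i \<noteq> 0"
  proof
    assume 0: "row A i \<bullet> row A i = 0"
    have "row A i $ j = 0" if "j < d" for j
      using 0 A that by (auto simp: scalar_prod_def sum_nonneg_eq_0_iff)
    then have "row A i = 0\<^sub>v d" using A by (intro eq_vecI) auto
    with row_nonzero[OF i] show False by simp
  qed
  moreover have "w $ i > 0" using w i unfolding positive_vec_def by auto
  ultimately have "(w $ i) powr (1 - 2 / p) * (row A i \<bullet> row A i)\<^sup>2 > 0" by simp
  with lev_bound[OF i x, of w] have "lev w i * form w (row A i) > 0" by linarith
  then show ?thesis using form_nonneg[of w "row A i"] by (simp add: zero_less_mult_iff)
qed

lemma lev_attained:
  assumes w: "positive_vec n w" and i: "i < n"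
  obtains x where "x \<in> carrier_vec d" "(row A i \<bullet> x)\<^sup>2 > 0" "form w x > 0"
    "(w $ i) powr (1 - 2 / p) * (row A i \<bullet> x)\<^sup>2 = lev w i * form w x"
proof -
  obtain x where x: "x \<in> carrier_vec d" "row (reweight p w A) i \<bullet> x = lev w i" "form w x = lev w i"
    using leverage_variational_attained[OF reweight_carrier i, of w] form_eq unfolding lev_def by metis
  have eq: "(w $ i) powr (1 - 2 / p) * (row A i \<bullet> x)\<^sup>2 = lev w i * form w x"
    using row_reweight_scalar_prod_sq[OF i x(1), of w] unfolding x(2,3) by (simp add: power2_eq_square)
  have "(row A i \<bullet> x)\<^sup>2 > 0" using eq lev_pos[OF w i] unfolding x(3) by auto
  with x eq lev_pos[OF w i] show thesis by (intro that[of x]) auto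
qed

text \<open>At an optimal \<open>x\<close>, the left side of \<open>lev_bound\<close> is a single
  summand of \<open>form w x\<close>.\<close>

lemma lev_le_1:
  assumes w: "positive_vec n w" and i: "i < n"
  shows "lev w i \<le> 1"
proof -
  obtain x where x: "form w x > 0" "(w $ i) powr (1 - 2 / p) * (row A i \<bullet> x)\<^sup>2 = lev w i * form w x"
    using lev_attained[OF w i] by metis
  have "(w $ i) powr (1 - 2 / p) * (row A i \<bullet> x)\<^sup>2 \<le> form w x"
    unfolding form_def using i by (intro member_le_sum[where f = "\<lambda>j. (w $ j) powr (1 - 2 / p) * (row A j \<bullet> x)\<^sup>2"]) auto
  with x show ?thesis by simp
qed

text \<open>\<open>lev w i / (w $ i) powr (1 - 2 / p)\<close> is the maximum of
  \<open>(row A i \<bullet> x)\<^sup>2 / form w x\<close>. The comparison of forms is therefore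
  tested at the \<open>x\<close> optimal for \<open>w'\<close>.\<close>

lemma lev_antimono:
  assumes w: "positive_vec n w" and w': "positive_vec n w'" and i: "i < n"
    and le: "\<And>x. x \<in> carrier_vec d \<Longrightarrow> \<kappa> * form w x \<le> form w' x"
  shows "\<kappa> * (lev w' i / (w' $ i) powr (1 - 2 / p)) \<le> lev w i / (w $ i) powr (1 - 2 / p)"
proof -
  have pos: "w $ i > 0" "w' $ i > 0" using w w' i unfolding positive_vec_def by auto
  obtain x where x: "x \<in> carrier_vec d" "(row A i \<bullet> x)\<^sup>2 > 0" "form w' x > 0"
    "(w' $ i) powr (1 - 2 / p) * (row A i \<bullet> x)\<^sup>2 = lev w' i * form w' x"
    using lev_attained[OF w' i] by metis
  define z where "z = (row A i \<bullet> x)\<^sup>2"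
  have z: "z > 0" using x unfolding z_def by simp
  have b: "(w $ i) powr (1 - 2 / p) * z \<le> lev w i * form w x"
    unfolding z_def by (rule lev_bound[OF i x(1)])
  have "lev w i * form w x > 0" using b z pos by (smt (verit) mult_pos_pos powr_gt_zero)
  then have f: "form w x > 0" using lev_pos[OF w i] by (simp add: zero_less_mult_iff)
  have "\<kappa> * (lev w' i / (w' $ i) powr (1 - 2 / p)) = \<kappa> * z / form w' x"
    using x pos unfolding z_def by (simp add: field_simps)
  also have "\<dots> \<le> z / form w x"
    using mult_right_mono[OF le[OF x(1)], of z] z f x(3) by (simp add: field_simps)
  also have "\<dots> \<le> lev w i / (w $ i) powr (1 - 2 / p)"
    using b pos f by (simp add: field_simps)
  finally show ?thesis .
qed

text \<open>Scaling multiplies the form by a constant, so \<open>lev_antimono\<close> applies in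
  both directions. The mean can thus be rescaled without changing its scores.\<close>

lemma lev_scale:
  assumes w: "positive_vec n w" and \<beta>: "\<beta> > 0" and w': "positive_vec n w'"
    and eq: "\<And>i. i < n \<Longrightarrow> w' $ i = \<beta> * w $ i" and i: "i < n"
  shows "lev w' i = lev w i"
proof -
  define b where "b = \<beta> powr (1 - 2 / p)"
  have b: "b > 0" unfolding b_def using \<beta> by simp
  have pow: "(w' $ j) powr (1 - 2 / p) = b * (w $ j) powr (1 - 2 / p)" if "j < n" for j
    unfolding eq[OF that] b_def by (rule powr_mult)
  have form: "form w' x = b * form w x" for x
    unfolding form_def sum_distrib_left by (intro sum.cong) (auto simp: pow)
  have pos: "(w $ i) powr (1 - 2 / p) > 0" using w i unfolding positive_vec_def by auto
  have "b * (lev w' i / (b * (w $ i) powr (1 - 2 / p))) \<le> lev w i / (w $ i) powr (1 - 2 / p)"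
    using lev_antimono[OF w w' i, of b] unfolding form pow[OF i] by simp
  moreover have "1 / b * (lev w i / (w $ i) powr (1 - 2 / p)) \<le> lev w' i / (b * (w $ i) powr (1 - 2 / p))"
    using lev_antimono[OF w' w i, of "1 / b"] b unfolding form pow[OF i] by simp
  ultimately show ?thesis using b pos by (simp add: field_simps)
qed

lemma sum_lev_le: "(\<Sum>i<n. lev w i) \<le> real d"
  unfolding lev_def by (rule sum_leverage_le[OF reweight_carrier])

text \<open>Two reweightings differ by a positive diagonal factor and so share their row space.
  Hence all iterates have the same total score.\<close>

lemma sum_lev_cong:
  assumes w: "positive_vec n w" and w': "positive_vec n w'"
  shows "(\<Sum>i<n. lev w i) = (\<Sum>i<n. lev w' i)"
proof -
  define e where "e = 1 / 2 - 1 / p"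
  have D: "reweight p w' A = mat_diag n (\<lambda>i. (w' $ i) powr e / (w $ i) powr e) * reweight p w A"
    if w: "positive_vec n w" for w w'
  proof -
    have "reweight p w A = mat_diag n (\<lambda>i. (w $ i) powr e) * A"
      unfolding reweight_def using A by (auto simp: e_def)
    then have "mat_diag n (\<lambda>i. (w' $ i) powr e / (w $ i) powr e) * reweight p w A
      = (mat_diag n (\<lambda>i. (w' $ i) powr e / (w $ i) powr e) * mat_diag n (\<lambda>i. (w $ i) powr e)) * A"
      using assoc_mult_mat[OF mat_diag_dim mat_diag_dim A] by metis
    also have "\<dots> = mat_diag n (\<lambda>i. (w' $ i) powr e / (w $ i) powr e * (w $ i) powr e) * A" by simp
    also have "mat_diag n (\<lambda>i. (w' $ i) powr e / (w $ i) powr e * (w $ i) powr e) = mat_diag n (\<lambda>i. (w' $ i) powr e)"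
      using w unfolding mat_diag_def positive_vec_def by (intro cong_mat) (auto simp: less_le)
    finally show ?thesis unfolding reweight_def using A by (auto simp: e_def)
  qed
  show ?thesis unfolding lev_def
    by (rule sum_leverage_cong[OF reweight_carrier reweight_carrier mat_diag_dim D[OF w] mat_diag_dim D[OF w']])
qed

end

section \<open>One-sided and two-sided approximation\<close>

context nonzero_rows
begin

text \<open>For suitable fixed \<open>x\<close>, \<open>ln (w $ i / lev w i)\<close> is at most
  \<open>2 / p * ln (w $ i) + ln (form w x / z)\<close>, both terms concave in \<open>w\<close>,
  with equality for optimal \<open>x\<close>. The \<open>x\<close> optimal for the mean
  \<open>v\<close> serves all \<open>W k\<close>, and Jensen is applied to each term.\<close>

lemma sum_ln_ratio_le_mean:
  assumes T: "T > 0" and W: "\<And>k. k < T \<Longrightarrow> positive_vec n (W k)" and v: "positive_vec n v"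
    and mean: "\<And>i. i < n \<Longrightarrow> v $ i = (\<Sum>k<T. W k $ i) / real T" and i: "i < n"
  shows "(\<Sum>k<T. ln (W k $ i / lev (W k) i)) \<le> real T * ln (v $ i / lev v i)"
proof -
  have Wpos: "W k $ j > 0" if "k < T" "j < n" for k j
    using W that unfolding positive_vec_def by auto
  have vi: "v $ i > 0" using v i unfolding positive_vec_def by auto
  obtain x where x: "x \<in> carrier_vec d" "(row A i \<bullet> x)\<^sup>2 > 0" "form v x > 0"
    "(v $ i) powr (1 - 2 / p) * (row A i \<bullet> x)\<^sup>2 = lev v i * form v x"
    using lev_attained[OF v i] by metis
  define z where "z = (row A i \<bullet> x)\<^sup>2"
  have z: "z > 0" using x unfolding z_def by simp
  have split: "y / y powr (1 - 2 / p) = y powr (2 / p)" if "y > 0" for y :: real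
    using that by (simp add: powr_diff)
  have form_pos: "form w x > 0" if "positive_vec n w" for w
  proof -
    have "0 < (w $ i) powr (1 - 2 / p) * z" using that i z unfolding positive_vec_def by auto
    also have "\<dots> \<le> lev w i * form w x" unfolding z_def by (rule lev_bound[OF i x(1)])
    finally show ?thesis using lev_pos[OF that i] by (simp add: zero_less_mult_iff)
  qed
  have ln_ratio: "ln (W k $ i / lev (W k) i) \<le> 2 / p * ln (W k $ i) + ln (form (W k) x / z)" if k: "k < T" for k
  proof -
    note pos = Wpos[OF k i] lev_pos[OF W[OF k] i] form_pos[OF W[OF k]]
    have "(W k $ i) powr (1 - 2 / p) * z \<le> lev (W k) i * form (W k) x"
      unfolding z_def by (rule lev_bound[OF i x(1)])
    then have "1 / lev (W k) i \<le> form (W k) x / z / (W k $ i) powr (1 - 2 / p)"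
      using pos z by (simp add: field_simps)
    then have "W k $ i / lev (W k) i \<le> W k $ i * (form (W k) x / z / (W k $ i) powr (1 - 2 / p))"
      using mult_left_mono[of "1 / lev (W k) i" "form (W k) x / z / (W k $ i) powr (1 - 2 / p)" "W k $ i"] pos by simp
    also have "\<dots> = (W k $ i / (W k $ i) powr (1 - 2 / p)) * (form (W k) x / z)" by simp
    also have "\<dots> = (W k $ i) powr (2 / p) * (form (W k) x / z)"
      unfolding split[OF pos(1)] ..
    finally have "ln (W k $ i / lev (W k) i) \<le> ln ((W k $ i) powr (2 / p) * (form (W k) x / z))"
      using pos z by simp
    also have "\<dots> = 2 / p * ln (W k $ i) + ln (form (W k) x / z)"
      using pos z by (subst ln_mult) (auto simp: ln_powr)
    finally show ?thesis .
  qed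
  have "(\<Sum>k<T. form (W k) x) = (\<Sum>j<n. (\<Sum>k<T. (W k $ j) powr (1 - 2 / p)) * (row A j \<bullet> x)\<^sup>2)"
    unfolding form_def sum_distrib_right by (rule sum.swap)
  also have "\<dots> \<le> (\<Sum>j<n. (real T * (v $ j) powr (1 - 2 / p)) * (row A j \<bullet> x)\<^sup>2)"
    using sum_powr_le_mean[OF T Wpos exponent] mean by (intro sum_mono mult_right_mono) auto
  also have "\<dots> = real T * form v x"
    unfolding form_def sum_distrib_left by (simp add: mult.assoc)
  finally have form_mean: "(\<Sum>k<T. form (W k) x / z) / real T \<le> form v x / z"
    using T z by (simp add: sum_divide_distrib[symmetric] field_simps)
  have "(\<Sum>k<T. ln (W k $ i / lev (W k) i)) \<le> (\<Sum>k<T. 2 / p * ln (W k $ i) + ln (form (W k) x / z))"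
    by (intro sum_mono ln_ratio) auto
  also have "\<dots> = 2 / p * (\<Sum>k<T. ln (W k $ i)) + (\<Sum>k<T. ln (form (W k) x / z))"
    by (simp add: sum.distrib sum_distrib_left)
  also have "\<dots> \<le> 2 / p * (real T * ln (v $ i)) + real T * ln (form v x / z)"
  proof (rule add_mono)
    show "2 / p * (\<Sum>k<T. ln (W k $ i)) \<le> 2 / p * (real T * ln (v $ i))"
      using sum_ln_le_mean[OF T Wpos[OF _ i]] mean[OF i] p by (intro mult_left_mono) auto
    have "(\<Sum>k<T. ln (form (W k) x / z)) \<le> real T * ln ((\<Sum>k<T. form (W k) x / z) / real T)"
      using form_pos[OF W] z by (intro sum_ln_le_mean[OF T]) auto
    also have "\<dots> \<le> real T * ln (form v x / z)"
    proof -
      have "(\<Sum>k<T. form (W k) x / z) > 0" using form_pos[OF W] z T by (intro sum_pos) auto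
      then show ?thesis using form_mean T by (intro mult_left_mono ln_mono) auto
    qed
    finally show "(\<Sum>k<T. ln (form (W k) x / z)) \<le> real T * ln (form v x / z)" .
  qed
  also have "\<dots> = real T * ln ((v $ i) powr (2 / p) * (form v x / z))"
    using vi x(3) z by (subst ln_mult) (auto simp: ln_powr algebra_simps)
  also have "(v $ i) powr (2 / p) * (form v x / z) = v $ i / lev v i"
  proof -
    have "form v x / z = (v $ i) powr (1 - 2 / p) / lev v i"
      using x(4) z lev_pos[OF v i] unfolding z_def by (simp add: field_simps)
    then show ?thesis using vi by (simp add: powr_add[symmetric])
  qed
  finally show ?thesis .
qed

text \<open>Each step bounds its log ratio below by \<open>ln (1 - \<delta>)\<close> minus a
  telescoping difference. Since \<open>W T\<close> is at most 2 and \<open>W 0\<close> is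
  \<open>d / n\<close>, the boundary terms amount to at most \<open>\<delta>\<close> per step, and
  \<open>\<delta> \<le> - ln (1 - \<delta>)\<close> accounts for the second factor
  \<open>1 - \<delta>\<close>.\<close>

lemma mean_one_sided:
  assumes T: "T > 0" and \<delta>: "0 < \<delta>" "\<delta> < 1" and LT: "ln (2 + 2 * (real n / real d)) \<le> \<delta> * real T"
    and n: "n \<ge> 1" and d: "d \<ge> 1"
    and W: "\<And>k. k \<le> T \<Longrightarrow> positive_vec n (W k)" and v: "positive_vec n v"
    and W0: "\<And>i. i < n \<Longrightarrow> W 0 $ i = real d / real n"
    and step: "\<And>k i. k < T \<Longrightarrow> i < n \<Longrightarrow> (1 - \<delta>) * lev (W k) i \<le> W (Suc k) $ i"
      "\<And>k i. k < T \<Longrightarrow> i < n \<Longrightarrow> W (Suc k) $ i \<le> (1 + \<delta>) * lev (W k) i"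
    and mean: "\<And>i. i < n \<Longrightarrow> v $ i = (\<Sum>k<T. W k $ i) / real T" and i: "i < n"
  shows "(1 - \<delta>)\<^sup>2 * lev v i \<le> v $ i"
proof -
  have Wpos: "W k $ i > 0" if "k \<le> T" for k using W[OF that] i unfolding positive_vec_def by auto
  have vi: "v $ i > 0" using v i unfolding positive_vec_def by auto
  have lnd: "ln (1 - \<delta>) \<le> - \<delta>" using ln_le_minus_one[of "1 - \<delta>"] \<delta> by simp
  obtain T' where T': "T = Suc T'" using T by (cases T) auto
  have "W T $ i \<le> (1 + \<delta>) * lev (W T') i" using step(2)[of T' i] T' i by simp
  also have "\<dots> \<le> 2 * 1" using lev_le_1[OF W[of T'] i] lev_pos[OF W[of T'] i] T' \<delta> by (intro mult_mono) auto
  finally have WT: "W T $ i \<le> 2" by simp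
  have "ln (W T $ i) - ln (W 0 $ i) = ln (W T $ i / (real d / real n))"
    using ln_divide_pos[of "W T $ i" "real d / real n"] Wpos[of T] n d W0[OF i] by simp
  also have "\<dots> \<le> ln (2 + 2 * (real n / real d))"
  proof -
    have "W T $ i / (real d / real n) \<le> 2 / (real d / real n)"
      using WT n d by (intro divide_right_mono) auto
    \<comment> \<open>The extra summand 2 keeps the logarithm positive also for \<open>n\<close>
      much smaller than \<open>d\<close>, so that the bound on it forces
      \<open>T > 0\<close>.\<close>
    also have "\<dots> \<le> 2 + 2 * (real n / real d)" by simp
    finally show ?thesis using Wpos[of T] n d by (intro ln_mono) auto
  qed
  finally have tele: "ln (W T $ i) - ln (W 0 $ i) \<le> \<delta> * real T" using LT by simp
  have "real T * (2 * ln (1 - \<delta>)) \<le> real T * ln (1 - \<delta>) - \<delta> * real T"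
    using mult_left_mono[OF lnd, of "real T"] by (simp add: algebra_simps)
  also have "\<dots> \<le> real T * ln (1 - \<delta>) - (ln (W T $ i) - ln (W 0 $ i))" using tele by simp
  also have "\<dots> = (\<Sum>k<T. ln (1 - \<delta>) - (ln (W (Suc k) $ i) - ln (W k $ i)))"
    unfolding sum_subtractf[where g = "\<lambda>k. ln (W (Suc k) $ i) - ln (W k $ i)"]
    using sum_lessThan_telescope[of "\<lambda>k. ln (W k $ i)" T] by simp
  also have "\<dots> \<le> (\<Sum>k<T. ln (W k $ i / lev (W k) i))"
  proof (rule sum_mono)
    fix k assume "k \<in> {..<T}"
    then have k: "k < T" by simp
    note pos = Wpos[of k] Wpos[of "Suc k"] lev_pos[OF W[of k] i]
    have "ln ((1 - \<delta>) * lev (W k) i) \<le> ln (W (Suc k) $ i)"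
      using step(1)[OF k i] pos k \<delta> by (intro ln_mono) auto
    moreover have "ln ((1 - \<delta>) * lev (W k) i) = ln (1 - \<delta>) + ln (lev (W k) i)"
      using pos k \<delta> by (intro ln_mult_pos) auto
    moreover have "ln (W k $ i / lev (W k) i) = ln (W k $ i) - ln (lev (W k) i)"
      using pos k by (simp add: ln_div)
    ultimately show "ln (1 - \<delta>) - (ln (W (Suc k) $ i) - ln (W k $ i)) \<le> ln (W k $ i / lev (W k) i)" by linarith
  qed
  also have "\<dots> \<le> real T * ln (v $ i / lev v i)"
    by (rule sum_ln_ratio_le_mean[OF T W v mean i]) auto
  finally have "2 * ln (1 - \<delta>) \<le> ln (v $ i / lev v i)" using T by simp
  then have "ln ((1 - \<delta>)\<^sup>2) \<le> ln (v $ i / lev v i)" using \<delta> by (simp add: ln_realpow)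
  then have "(1 - \<delta>)\<^sup>2 \<le> v $ i / lev v i" using \<delta> vi lev_pos[OF v i] by simp
  then show ?thesis using lev_pos[OF v i] by (simp add: field_simps)
qed

text \<open>The choice of \<open>w\<close> turns \<open>w $ i / (w $ i) powr a\<close> into
  \<open>s $ i / (u $ i) powr a\<close>, a \<open>\<delta>\<close>-approximation of
  \<open>lev u i / (u $ i) powr a\<close>. It remains to compare forms: \<open>s \<le> u\<close>
  makes \<open>form w x\<close> at most \<open>form u x\<close>, and at most the fraction
  \<open>\<gamma>\<close> is lost.\<close>

lemma two_sided_of_one_sided:
  assumes u: "positive_vec n u" and w: "positive_vec n w" and \<delta>: "0 < \<delta>" "\<delta> < 1"
    and s: "\<And>i. i < n \<Longrightarrow> (1 - \<delta>) * lev u i \<le> s $ i" "\<And>i. i < n \<Longrightarrow> s $ i \<le> (1 + \<delta>) * lev u i"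
    and su: "\<And>i. i < n \<Longrightarrow> s $ i \<le> u $ i"
    and weq: "\<And>i. i < n \<Longrightarrow> w $ i = u $ i * (s $ i / u $ i) powr (p / 2)"
    and i: "i < n"
  defines "\<gamma> \<equiv> (p / 2 - 1) / (1 - \<delta>) * ((\<Sum>j<n. u $ j) - (\<Sum>j<n. s $ j))"
  shows "(1 - \<delta>) * (1 - \<gamma>) * lev w i \<le> w $ i" and "w $ i \<le> (1 + \<delta>) * lev w i"
proof -
  define a q where "a = 1 - 2 / p" and "q = p / 2 - 1"
  have q: "q \<ge> 0" unfolding q_def using p by simp
  have up: "u $ j > 0" and wp: "w $ j > 0" and sp: "s $ j > 0" if j: "j < n" for j
    using u w less_le_trans[OF mult_pos_pos s(1)[OF j]] lev_pos[OF u j] j \<delta> unfolding positive_vec_def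
    by auto
  have wa: "(w $ j) powr a = (u $ j) powr a * (s $ j / u $ j) powr q" if j: "j < n" for j
  proof -
    have "p / 2 * a = q" unfolding a_def q_def using p by (simp add: field_simps)
    then show ?thesis unfolding weq[OF j] by (simp add: powr_mult powr_powr)
  qed
  have r1: "(s $ j / u $ j) powr q \<le> 1" if j: "j < n" for j
    using q up[OF j] sp[OF j] su[OF j] powr_mono2[of q "s $ j / u $ j" 1] by simp
  have ratio: "w $ i / (w $ i) powr a = s $ i / (u $ i) powr a"
  proof -
    have "(s $ i / u $ i) powr (p / 2) = (s $ i / u $ i) powr q * (s $ i / u $ i)"
      using up[OF i] sp[OF i] powr_add[of "s $ i / u $ i" q 1] unfolding q_def by simp
    then have "w $ i = (s $ i / u $ i) powr q * s $ i"
      using up[OF i] weq[OF i] by simp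
    then show ?thesis unfolding wa[OF i] using up[OF i] sp[OF i] by simp
  qed
  have ua: "(u $ i) powr a > 0" "(w $ i) powr a > 0" using up[OF i] wp[OF i] by auto
  have "1 * form w x \<le> form u x" for x
    unfolding form_def a_def[symmetric] using wa r1 up
    by (simp, intro sum_mono mult_right_mono) (auto simp: mult_left_le)
  from lev_antimono[OF w u i this]
  have 1: "lev u i / (u $ i) powr a \<le> lev w i / (w $ i) powr a" unfolding a_def by simp
  have "w $ i / (w $ i) powr a \<le> (1 + \<delta>) * (lev u i / (u $ i) powr a)"
    unfolding ratio using s(2)[OF i] ua by (simp add: divide_right_mono)
  also have "\<dots> \<le> (1 + \<delta>) * (lev w i / (w $ i) powr a)" using 1 \<delta> by (intro mult_left_mono) auto
  finally show "w $ i \<le> (1 + \<delta>) * lev w i" using ua by (simp add: field_simps)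
  have "(1 - \<gamma>) * form u x \<le> form w x" if x: "x \<in> carrier_vec d" for x
  proof -
    have "form u x - form w x = (\<Sum>j<n. (1 - (s $ j / u $ j) powr q) * ((u $ j) powr a * (row A j \<bullet> x)\<^sup>2))"
      unfolding form_def a_def[symmetric] sum_subtractf[symmetric]
      by (intro sum.cong) (auto simp: wa algebra_simps)
    also have "\<dots> \<le> (\<Sum>j<n. q / (1 - \<delta>) * (u $ j - s $ j) * form u x)"
    proof (rule sum_mono)
      fix j assume "j \<in> {..<n}"
      then have j: "j < n" by simp
      define r where "r = s $ j / u $ j"
      have r: "r > 0" "s $ j = u $ j * r" "r powr q \<le> 1" unfolding r_def using up[OF j] sp[OF j] r1[OF j] by auto
      \<comment> \<open>Passing to \<open>lev u j\<close> and then to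
        \<open>s $ j / (1 - \<delta>)\<close> supplies the factor \<open>r\<close> needed by
        \<open>mult_one_minus_powr_le\<close>, which produces the slack
        \<open>u $ j - s $ j\<close>.\<close>
      have "(1 - r powr q) * ((u $ j) powr a * (row A j \<bullet> x)\<^sup>2) \<le> (1 - r powr q) * (lev u j * form u x)"
        using lev_bound[OF j x, of u] r unfolding a_def by (intro mult_left_mono) auto
      also have "\<dots> \<le> (1 - r powr q) * (u $ j * r / (1 - \<delta>) * form u x)"
        using s(1)[OF j] r form_nonneg[of u x] \<delta> by (intro mult_left_mono mult_right_mono) (auto simp: field_simps)
      also have "\<dots> = u $ j / (1 - \<delta>) * form u x * (r * (1 - r powr q))" by simp
      also have "\<dots> \<le> u $ j / (1 - \<delta>) * form u x * (q * (1 - r))"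
        using mult_one_minus_powr_le[OF q r(1)] up[OF j] \<delta> form_nonneg[of u x] by (intro mult_left_mono) auto
      also have "\<dots> = q / (1 - \<delta>) * (u $ j - s $ j) * form u x" unfolding r(2)
        using \<delta> by (simp add: field_simps)
      finally show "(1 - (s $ j / u $ j) powr q) * ((u $ j) powr a * (row A j \<bullet> x)\<^sup>2)
        \<le> q / (1 - \<delta>) * (u $ j - s $ j) * form u x" unfolding r_def .
    qed
    also have "\<dots> = \<gamma> * form u x"
      unfolding \<gamma>_def q_def[symmetric]
      by (simp only: sum_distrib_right[symmetric] sum_distrib_left[symmetric] sum_subtractf)
    finally show ?thesis by (simp add: algebra_simps)
  qed
  from lev_antimono[OF u w i this]
  have 2: "(1 - \<gamma>) * (lev w i / (w $ i) powr a) \<le> lev u i / (u $ i) powr a" unfolding a_def by simp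
  have "(1 - \<delta>) * ((1 - \<gamma>) * (lev w i / (w $ i) powr a)) \<le> (1 - \<delta>) * (lev u i / (u $ i) powr a)"
    using 2 \<delta> by (intro mult_left_mono) auto
  also have "\<dots> \<le> w $ i / (w $ i) powr a"
    unfolding ratio using s(1)[OF i] ua by (simp add: divide_right_mono)
  finally have "(1 - \<delta>) * (1 - \<gamma>) * lev w i / (w $ i) powr a \<le> w $ i / (w $ i) powr a"
    by (simp add: mult.assoc)
  then show "(1 - \<delta>) * (1 - \<gamma>) * lev w i \<le> w $ i"
    using ua by (meson divide_le_cancel less_asym)
qed

text \<open>The initial iterate has total \<open>d\<close>; each later one has at most
  \<open>1 + \<delta>\<close> times the total score, which is the same for all weights. Averaging
  divides the initial \<open>d\<close> by \<open>T\<close>.\<close>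

lemma sum_mean_le:
  assumes T: "T > 0" and \<delta>: "0 < \<delta>" and n: "n \<ge> 1"
    and W: "\<And>k. k < T \<Longrightarrow> positive_vec n (W k)" and v: "positive_vec n v"
    and W0: "\<And>i. i < n \<Longrightarrow> W 0 $ i = real d / real n"
    and step: "\<And>k i. k < T \<Longrightarrow> i < n \<Longrightarrow> W (Suc k) $ i \<le> (1 + \<delta>) * lev (W k) i"
    and mean: "\<And>i. i < n \<Longrightarrow> v $ i = (\<Sum>k<T. W k $ i) / real T"
  shows "(\<Sum>i<n. v $ i) \<le> real d / real T + (1 + \<delta>) * (\<Sum>i<n. lev v i)"
proof -
  define R where "R = (\<Sum>i<n. lev v i)"
  have R: "R \<ge> 0" unfolding R_def using lev_pos[OF v] by (intro sum_nonneg) (auto simp: order_less_imp_le)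
  have b: "(\<Sum>i<n. W k $ i) \<le> (if k = 0 then real d else 0) + (1 + \<delta>) * R" if k: "k < T" for k
  proof (cases k)
    case 0
    have "(\<Sum>i<n. W 0 $ i) = (\<Sum>i<n. real d / real n)" by (intro sum.cong) (auto simp: W0)
    also have "\<dots> = real d" using n by simp
    finally show ?thesis using 0 R \<delta> by simp
  next
    case (Suc l)
    have "(\<Sum>i<n. W k $ i) \<le> (\<Sum>i<n. (1 + \<delta>) * lev (W l) i)"
      unfolding Suc using step[of l] k Suc by (intro sum_mono) auto
    also have "\<dots> = (1 + \<delta>) * (\<Sum>i<n. lev (W l) i)" by (simp add: sum_distrib_left)
    also have "(\<Sum>i<n. lev (W l) i) = R" unfolding R_def using W[of l] k Suc v by (intro sum_lev_cong) auto
    finally show ?thesis using Suc by simp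
  qed
  have "real T * (\<Sum>i<n. v $ i) = (\<Sum>i<n. \<Sum>k<T. W k $ i)"
    unfolding sum_distrib_left using T by (intro sum.cong) (auto simp: mean)
  also have "\<dots> = (\<Sum>k<T. \<Sum>i<n. W k $ i)" by (rule sum.swap)
  also have "\<dots> \<le> (\<Sum>k<T. (if k = 0 then real d else 0) + (1 + \<delta>) * R)" by (intro sum_mono b) auto
  also have "\<dots> = real d + real T * ((1 + \<delta>) * R)" using T by (simp add: sum.distrib)
  finally show ?thesis unfolding R_def[symmetric] using T by (simp add: field_simps)
qed

section \<open>Oracle answers and the goal, entry by entry\<close>

lemma leverage_reweight_carrier: "leverage (reweight p w A) \<in> carrier_vec n"
  unfolding leverage_def using reweight_carrier[of w] by simp

lemma approx_leverageD:
  assumes "approx_leverage \<delta> p A u s"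
  shows "s \<in> carrier_vec n"
    and "i < n \<Longrightarrow> (1 - \<delta>) * lev u i \<le> s $ i" and "i < n \<Longrightarrow> s $ i \<le> (1 + \<delta>) * lev u i"
proof -
  have dim: "dim_vec (leverage (reweight p u A)) = n"
    using leverage_reweight_carrier by (rule carrier_vecD)
  have *: "(1 - \<delta>) \<cdot>\<^sub>v leverage (reweight p u A) \<le> s" "s \<le> (1 + \<delta>) \<cdot>\<^sub>v leverage (reweight p u A)"
    using assms unfolding approx_leverage_def by simp_all
  then have s: "dim_vec s = n" unfolding less_eq_vec_def by (simp add: dim)
  then show "s \<in> carrier_vec n" by (rule carrier_vecI)
  assume "i < n"
  then show "(1 - \<delta>) * lev u i \<le> s $ i" "s $ i \<le> (1 + \<delta>) * lev u i"
    using * unfolding less_eq_vec_def lev_def by (simp_all add: dim s)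
qed

lemma two_sided_lewisI:
  assumes w: "positive_vec n w" and "\<And>i. i < n \<Longrightarrow> (1 - \<epsilon>) * lev w i \<le> w $ i"
    and "\<And>i. i < n \<Longrightarrow> w $ i \<le> (1 + \<epsilon>) * lev w i"
  shows "two_sided_lewis \<epsilon> p A w"
proof -
  have dim: "dim_vec (leverage (reweight p w A)) = n"
    using leverage_reweight_carrier by (rule carrier_vecD)
  have dw: "dim_vec w = n" and dA: "dim_row A = n" using w A unfolding positive_vec_def by simp_all
  have "(1 - \<epsilon>) \<cdot>\<^sub>v leverage (reweight p w A) \<le> w"
    using assms(2) unfolding less_eq_vec_def lev_def by (simp add: dim dw)
  moreover have "w \<le> (1 + \<epsilon>) \<cdot>\<^sub>v leverage (reweight p w A)"
    using assms(3) unfolding less_eq_vec_def lev_def by (simp add: dim dw)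
  ultimately show ?thesis using w unfolding two_sided_lewis_def dA by simp
qed

text \<open>This makes every answer a legal next query.\<close>

lemma approx_leverage_positive:
  assumes "positive_vec n u" "approx_leverage \<delta> p A u s" "\<delta> < 1"
  shows "positive_vec n s"
  unfolding positive_vec_def
proof (intro conjI allI impI)
  fix i assume i: "i < n"
  have "0 < (1 - \<delta>) * lev u i" using lev_pos[OF assms(1) i] assms(3) by simp
  also have "\<dots> \<le> s $ i" by (rule approx_leverageD(2)[OF assms(2) i])
  finally show "0 < s $ i" .
qed (rule approx_leverageD(1)[OF assms(2)])

text \<open>The total slack of \<open>u\<close> over \<open>s\<close> is of order
  \<open>\<delta> * d\<close> and enters \<open>\<gamma>\<close> with a factor of order
  \<open>p\<close>; this dictates the size of \<open>\<delta>\<close>.\<close>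

lemma two_sided_lewis_of_iterates:
  assumes \<epsilon>: "0 < \<epsilon>" "\<epsilon> < 1" and n: "n \<ge> 1" and d: "d \<ge> 1"
    and \<delta>: "\<delta> = \<epsilon> / (100 * (p * real d))"
    and LT: "ln (2 + 2 * (real n / real d)) \<le> \<delta> * real T"
    and W: "\<And>k. k \<le> T \<Longrightarrow> positive_vec n (W k)"
    and W0: "\<And>i. i < n \<Longrightarrow> W 0 $ i = real d / real n"
    and step: "\<And>k. k < T \<Longrightarrow> approx_leverage \<delta> p A (W k) (W (Suc k))"
    and u: "positive_vec n u"
    and ueq: "\<And>i. i < n \<Longrightarrow> u $ i = (1 + \<delta>) / ((1 - \<delta>)\<^sup>2 * real T) * (\<Sum>k<T. W k $ i)"
    and s: "approx_leverage \<delta> p A u s"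
    and w: "positive_vec n w"
    and weq: "\<And>i. i < n \<Longrightarrow> w $ i = u $ i * (s $ i / u $ i) powr (p / 2)"
  shows "two_sided_lewis \<epsilon> p A w"
proof -
  have pd: "p * real d \<ge> 2" using p d mult_mono[of 2 p 1 "real d"] by simp
  have \<delta>pos: "\<delta> > 0" unfolding \<delta> using \<epsilon> pd by simp
  have \<delta>eq: "p * real d * \<delta> = \<epsilon> / 100" unfolding \<delta> using p d by simp
  have "2 * \<delta> \<le> p * real d * \<delta>" using pd \<delta>pos by (intro mult_right_mono) auto
  then have \<delta>le: "\<delta> \<le> \<epsilon> / 200" using \<delta>eq by linarith
  have \<delta>1: "\<delta> < 1" "\<delta> \<le> 1 / 200" using \<delta>le \<epsilon> by auto
  \<comment> \<open>For all \<open>n\<close> and \<open>d\<close>, \<open>LT\<close> forces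
    \<open>\<delta> * T\<close> to be at least 1/2; this gives \<open>T > 0\<close> and, below,
    bounds \<open>d / T\<close> by \<open>2 * \<delta> * d\<close>.\<close>
  have "ln 2 \<le> ln (2 + 2 * (real n / real d))" by (intro ln_mono) auto
  moreover have "ln (2::real) \<ge> 1 / 2" using ln_le_minus_one[of "1 / 2 :: real"] by (simp add: ln_div)
  ultimately have T12: "1 / 2 \<le> \<delta> * real T" using LT by linarith
  have T: "T > 0" using T12 by (cases T) auto
  \<comment> \<open>\<open>\<beta>\<close> makes up for the factor
    \<open>(1 - \<delta>)\<^sup>2\<close> of \<open>mean_one_sided\<close> and for the overshoot
    \<open>1 + \<delta>\<close> of the last answer, so that \<open>s \<le> u\<close>.\<close>
  define \<beta> where "\<beta> = (1 + \<delta>) / (1 - \<delta>)\<^sup>2"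
  have \<beta>pos: "\<beta> > 0" unfolding \<beta>_def using \<delta>pos \<delta>1 by simp
  define v where "v = vec n (\<lambda>i. (\<Sum>k<T. W k $ i) / real T)"
  have mean: "v $ i = (\<Sum>k<T. W k $ i) / real T" if "i < n" for i unfolding v_def using that by simp
  have ubv: "u $ i = \<beta> * v $ i" if "i < n" for i
    unfolding ueq[OF that] mean[OF that] \<beta>_def by simp
  have v: "positive_vec n v"
    unfolding positive_vec_def
  proof (intro conjI allI impI)
    fix i assume i: "i < n"
    have "0 < \<beta> * v $ i" using u i ubv[OF i] unfolding positive_vec_def by auto
    then show "0 < v $ i" using \<beta>pos by (simp add: zero_less_mult_iff)
  qed (simp add: v_def)
  have levuv: "lev u i = lev v i" if "i < n" for i
    by (rule lev_scale[OF v \<beta>pos u ubv that])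
  note st = approx_leverageD[OF step]
  note sa = approx_leverageD[OF s]
  have one: "(1 - \<delta>)\<^sup>2 * lev v i \<le> v $ i" if "i < n" for i
    by (rule mean_one_sided[OF T \<delta>pos \<delta>1(1) LT n d W v W0 st(2) st(3) mean that])
  have su: "s $ i \<le> u $ i" if i: "i < n" for i
  proof -
    have "s $ i \<le> (1 + \<delta>) * lev v i" using sa(3)[OF i] levuv[OF i] by simp
    also have "\<dots> = \<beta> * ((1 - \<delta>)\<^sup>2 * lev v i)" unfolding \<beta>_def using \<delta>1 by simp
    also have "\<dots> \<le> u $ i" unfolding ubv[OF i] using one[OF i] \<beta>pos by (intro mult_left_mono) auto
    finally show ?thesis .
  qed
  define R where "R = (\<Sum>i<n. lev v i)"
  have R: "R \<le> real d" unfolding R_def by (rule sum_lev_le)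
  have \<delta>2: "\<delta> * \<delta> \<le> \<delta> / 200" using mult_left_mono[OF \<delta>1(2), of \<delta>] \<delta>pos by simp
  have \<beta>le: "\<beta> \<le> 1 + 4 * \<delta>"
  proof -
    have "(1 + 4 * \<delta>) * (1 - \<delta>)\<^sup>2 = 1 + 2 * \<delta> - 7 * (\<delta> * \<delta>) + 4 * (\<delta> * \<delta> * \<delta>)"
      by (simp add: power2_eq_square algebra_simps)
    moreover have "\<delta> * \<delta> * \<delta> \<ge> 0" using \<delta>pos by simp
    ultimately have "1 + \<delta> \<le> (1 + 4 * \<delta>) * (1 - \<delta>)\<^sup>2" using \<delta>2 \<delta>pos by linarith
    then show ?thesis unfolding \<beta>_def using \<delta>1 by (simp add: field_simps)
  qed
  have "real d / real T \<le> 2 * \<delta> * real d"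
    using mult_left_mono[OF T12, of "2 * real d"] T by (simp add: field_simps)
  then have Sv: "(\<Sum>i<n. v $ i) \<le> 2 * \<delta> * real d + (1 + \<delta>) * R"
    using sum_mean_le[OF T \<delta>pos n W v W0 st(3) mean] unfolding R_def by simp
  have "(\<Sum>i<n. u $ i) = \<beta> * (\<Sum>i<n. v $ i)"
    unfolding sum_distrib_left by (intro sum.cong) (auto simp: ubv)
  also have "\<dots> \<le> (1 + 4 * \<delta>) * (2 * \<delta> * real d + (1 + \<delta>) * R)"
    using \<beta>le Sv \<beta>pos v by (intro mult_mono) (auto simp: positive_vec_def order_less_imp_le intro!: sum_nonneg)
  finally have Su: "(\<Sum>i<n. u $ i) \<le> (1 + 4 * \<delta>) * (2 * \<delta> * real d + (1 + \<delta>) * R)" .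
  have "(1 - \<delta>) * R \<le> (\<Sum>i<n. s $ i)"
    unfolding R_def sum_distrib_left using sa(2) levuv by (intro sum_mono) auto
  \<comment> \<open>The total score \<open>R\<close> occurs on both sides, so only terms of order
    \<open>\<delta>\<close> remain.\<close>
  with Su have "(\<Sum>i<n. u $ i) - (\<Sum>i<n. s $ i) \<le> (1 + 4 * \<delta>) * (2 * \<delta> * real d + (1 + \<delta>) * R) - (1 - \<delta>) * R"
    by linarith
  also have "\<dots> = (2 * \<delta> + 8 * (\<delta> * \<delta>)) * real d + (6 * \<delta> + 4 * (\<delta> * \<delta>)) * R"
    by (simp add: algebra_simps)
  also have "\<dots> \<le> (2 * \<delta> + 8 * (\<delta> * \<delta>)) * real d + (6 * \<delta> + 4 * (\<delta> * \<delta>)) * real d"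
    using R \<delta>pos by (intro add_left_mono mult_left_mono) auto
  also have "\<dots> = (8 * \<delta> + 12 * (\<delta> * \<delta>)) * real d" by (simp add: algebra_simps)
  also have "\<dots> \<le> (9 * \<delta>) * real d" using \<delta>2 \<delta>pos by (intro mult_right_mono) auto
  finally have slack: "(\<Sum>i<n. u $ i) - (\<Sum>i<n. s $ i) \<le> 9 * \<delta> * real d" .
  \<comment> \<open>The prefactor is at most \<open>p\<close>, so \<open>\<gamma>\<close> is at most
    \<open>9 * p * d * \<delta> = 9 * \<epsilon> / 100\<close>, which leaves room for the factor
    \<open>1 - \<delta>\<close>.\<close>
  define \<gamma> where "\<gamma> = (p / 2 - 1) / (1 - \<delta>) * ((\<Sum>j<n. u $ j) - (\<Sum>j<n. s $ j))"
  have "\<gamma> \<le> (p / 2 - 1) / (1 - \<delta>) * (9 * \<delta> * real d)"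
    unfolding \<gamma>_def using slack p \<delta>1 by (intro mult_left_mono) auto
  also have "\<dots> \<le> p * (9 * \<delta> * real d)"
  proof (intro mult_right_mono)
    have "p * (1 - \<delta>) \<ge> p * (1 / 2)" using p \<delta>1 by (intro mult_left_mono) auto
    then show "(p / 2 - 1) / (1 - \<delta>) \<le> p" using \<delta>1 by (simp add: field_simps)
  qed (use \<delta>pos in auto)
  also have "\<dots> = 9 * (p * real d * \<delta>)" by simp
  finally have \<gamma>: "\<gamma> \<le> 9 * \<epsilon> / 100" unfolding \<delta>eq by simp
  have prod: "(1 - \<delta>) * (1 - \<gamma>) \<ge> 1 - \<epsilon>"
  proof -
    have "(1 - \<epsilon> / 200) * (1 - 9 * \<epsilon> / 100) \<le> (1 - \<delta>) * (1 - \<gamma>)"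
      using \<gamma> \<delta>le \<epsilon> by (intro mult_mono) auto
    moreover have "(1 - \<epsilon> / 200) * (1 - 9 * \<epsilon> / 100) = 1 - 19 * \<epsilon> / 200 + 9 * (\<epsilon> * \<epsilon>) / 20000"
      by (simp add: field_simps)
    moreover have "\<epsilon> * \<epsilon> \<ge> 0" by simp
    ultimately show ?thesis using \<epsilon> by linarith
  qed
  note ts = two_sided_of_one_sided[OF u w \<delta>pos \<delta>1(1) sa(2) sa(3) su weq, folded \<gamma>_def]
  show ?thesis
  proof (rule two_sided_lewisI[OF w])
    fix i assume i: "i < n"
    have lp: "lev w i > 0" by (rule lev_pos[OF w i])
    have "(1 - \<epsilon>) * lev w i \<le> (1 - \<delta>) * (1 - \<gamma>) * lev w i"
      using prod lp by (intro mult_right_mono) auto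
    also have "\<dots> \<le> w $ i" by (rule ts(1)[OF _ _ _ _ i])
    finally show "(1 - \<epsilon>) * lev w i \<le> w $ i" .
    have "w $ i \<le> (1 + \<delta>) * lev w i" by (rule ts(2)[OF _ _ _ _ i])
    also have "\<dots> \<le> (1 + \<epsilon>) * lev w i" using \<delta>le \<epsilon> lp by (intro mult_right_mono) auto
    finally show "w $ i \<le> (1 + \<epsilon>) * lev w i" .
  qed
qed

end

section \<open>The program\<close>

lemma num_queries_straight_line: "num_queries (foldr Query qs (Output ts)) = length qs"
  by (induction qs) auto

text \<open>Without branches it suffices to consider transcripts \<open>hs\<close>, where query
  \<open>k\<close> sees only \<open>take k hs\<close>. The induction generalizes \<open>h\<close>,
  since it moves the first answer from \<open>hs\<close> to \<open>h\<close>.\<close>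

lemma computes_straight_line:
  assumes "\<And>hs. length hs < length qs \<Longrightarrow>
      (\<And>k. k < length hs \<Longrightarrow> answer (rterms_vec (h @ take k hs) (qs ! k)) (hs ! k)) \<Longrightarrow>
      valid (rterms_vec (h @ hs) (qs ! length hs))"
    and "\<And>hs. length hs = length qs \<Longrightarrow>
      (\<And>k. k < length hs \<Longrightarrow> answer (rterms_vec (h @ take k hs) (qs ! k)) (hs ! k)) \<Longrightarrow>
      goal (rterms_vec (h @ hs) ts)"
  shows "computes valid answer goal (foldr Query qs (Output ts)) h"
  using assms
proof (induction qs arbitrary: h)
  case Nil
  from Nil(2)[of "[]"] show ?case by simp
next
  case (Cons q qs)
  have "computes valid answer goal (foldr Query qs (Output ts)) (h @ [s])"
    if s: "answer (rterms_vec h q) s" for s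
  proof (rule Cons.IH)
    fix hs assume hs: "length hs < length qs"
      "\<And>k. k < length hs \<Longrightarrow> answer (rterms_vec ((h @ [s]) @ take k hs) (qs ! k)) (hs ! k)"
    have "answer (rterms_vec (h @ take k (s # hs)) ((q # qs) ! k)) ((s # hs) ! k)" if "k < length (s # hs)" for k
      using that hs(2)[of "k - 1"] s by (cases k) auto
    from Cons.prems(1)[OF _ this] hs(1) show "valid (rterms_vec ((h @ [s]) @ hs) (qs ! length hs))" by simp
  next
    fix hs assume hs: "length hs = length qs"
      "\<And>k. k < length hs \<Longrightarrow> answer (rterms_vec ((h @ [s]) @ take k hs) (qs ! k)) (hs ! k)"
    have "answer (rterms_vec (h @ take k (s # hs)) ((q # qs) ! k)) ((s # hs) ! k)" if "k < length (s # hs)" for k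
      using that hs(2)[of "k - 1"] s by (cases k) auto
    from Cons.prems(2)[OF _ this] hs(1) show "goal (rterms_vec ((h @ [s]) @ hs) ts)" by simp
  qed
  moreover have "valid (rterms_vec h q)" using Cons.prems(1)[of "[]"] by simp
  ultimately show ?case by simp
qed

section \<open>Terms for the iterates, the mean and the output\<close>

lemma rterms_vec_map_upt: "rterms_vec h (map f [0..<n]) = vec n (\<lambda>i. rterm_val h (f i))"
  unfolding rterms_vec_def by (intro eq_vecI) (auto simp: vec_of_list_index)

lemma rterm_val_foldr_Plus:
  "rterm_val h (foldr Plus (map f [0..<m]) (Num 0)) = (\<Sum>k<m. rterm_val h (f k))"
proof -
  have "rterm_val h (foldr Plus ts (Num 0)) = sum_list (map (rterm_val h) ts)" for ts
    by (induction ts) auto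
  then show ?thesis by (simp add: interv_sum_list_conv_sum_set_nat atLeast0LessThan comp_def)
qed

text \<open>The indices shift by one because the answer to the query at iterate \<open>l\<close> is
  itself iterate \<open>l + 1\<close>.\<close>

definition iterate_term :: "nat \<Rightarrow> nat \<Rightarrow> nat \<Rightarrow> nat \<Rightarrow> rterm" where
  "iterate_term n d k i = (case k of 0 \<Rightarrow> Num (real d / real n) | Suc l \<Rightarrow> Ans l i)"

definition mean_term :: "nat \<Rightarrow> nat \<Rightarrow> real \<Rightarrow> nat \<Rightarrow> nat \<Rightarrow> rterm" where
  "mean_term n d \<delta> T i = Times (Num ((1 + \<delta>) / ((1 - \<delta>)\<^sup>2 * real T)))
     (foldr Plus (map (\<lambda>k. iterate_term n d k i) [0..<T]) (Num 0))"

text \<open>Answer \<open>T\<close> belongs to the last query, the one at the rescaled mean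
  \<open>u\<close>, so \<open>Ans T i\<close> is the entry \<open>s $ i\<close> of the
  analysis.\<close>

definition lewis_prog :: "nat \<Rightarrow> nat \<Rightarrow> real \<Rightarrow> real \<Rightarrow> nat \<Rightarrow> oracle_prog" where
  "lewis_prog n d p \<delta> T = foldr Query
     (map (\<lambda>k. map (iterate_term n d k) [0..<n]) [0..<T] @ [map (mean_term n d \<delta> T) [0..<n]])
     (Output (map (\<lambda>i. Times (mean_term n d \<delta> T i)
        (Power (Divide (Ans T i) (mean_term n d \<delta> T i)) (Num (p / 2)))) [0..<n]))"

text \<open>Iterate \<open>k\<close> refers only to answers with index below \<open>k\<close>, so
  its value when queried is also its value at the end.\<close>

lemma rterm_val_iterate_take:
  "k \<le> m \<Longrightarrow> rterm_val (take m h) (iterate_term n d k i) = rterm_val h (iterate_term n d k i)"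
  unfolding iterate_term_def by (auto split: nat.splits)

lemma rterm_val_mean_take:
  "T \<le> m \<Longrightarrow> rterm_val (take m h) (mean_term n d \<delta> T i) = rterm_val h (mean_term n d \<delta> T i)"
  unfolding mean_term_def by (simp add: rterm_val_foldr_Plus rterm_val_iterate_take)

context nonzero_rows
begin

text \<open>Partial transcripts \<open>h\<close> are covered because a query must be shown valid
  before later answers exist. Positivity passes from each query to its answer.\<close>

lemma iterates_positive:
  assumes n: "n \<ge> 1" and d: "d \<ge> 1" and \<delta>: "\<delta> < 1"
    and ans: "\<And>k. k < length h \<Longrightarrow> k < T \<Longrightarrow>
      approx_leverage \<delta> p A (vec n (\<lambda>i. rterm_val h (iterate_term n d k i))) (h ! k)"
  shows "k \<le> length h \<Longrightarrow> k \<le> T \<Longrightarrow> positive_vec n (vec n (\<lambda>i. rterm_val h (iterate_term n d k i)))"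
    and "k < length h \<Longrightarrow> k < T \<Longrightarrow> vec n (\<lambda>i. rterm_val h (iterate_term n d (Suc k) i)) = h ! k"
proof -
  have eq: "vec n (\<lambda>i. rterm_val h (iterate_term n d (Suc k) i)) = h ! k" if k: "k < length h" "k < T" for k
    using approx_leverageD(1)[OF ans[OF k]] k by (intro eq_vecI) (auto simp: iterate_term_def)
  then show "k < length h \<Longrightarrow> k < T \<Longrightarrow> vec n (\<lambda>i. rterm_val h (iterate_term n d (Suc k) i)) = h ! k" .
  show "k \<le> length h \<Longrightarrow> k \<le> T \<Longrightarrow> positive_vec n (vec n (\<lambda>i. rterm_val h (iterate_term n d k i)))"
  proof (induction k)
    case 0
    show ?case using n d by (auto simp: positive_vec_def iterate_term_def)
  next
    case (Suc k)
    then have k: "k < length h" "k < T" by auto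
    show ?case unfolding eq[OF k] using Suc k by (intro approx_leverage_positive[OF _ ans[OF k] \<delta>]) auto
  qed
qed

lemma computes_lewis_prog:
  assumes \<epsilon>: "0 < \<epsilon>" "\<epsilon> < 1" and n: "n \<ge> 1" and d: "d \<ge> 1"
    and \<delta>: "\<delta> = \<epsilon> / (100 * (p * real d))"
    and LT: "ln (2 + 2 * (real n / real d)) \<le> \<delta> * real T"
  shows "computes (positive_vec n) (approx_leverage \<delta> p A) (two_sided_lewis \<epsilon> p A) (lewis_prog n d p \<delta> T) []"
proof -
  define qs where "qs = map (\<lambda>k. map (iterate_term n d k) [0..<n]) [0..<T] @ [map (mean_term n d \<delta> T) [0..<n]]"
  have len: "length qs = Suc T" unfolding qs_def by simp
  have qsk: "qs ! k = map (iterate_term n d k) [0..<n]" if "k < T" for k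
    unfolding qs_def using that by (simp add: nth_append)
  have qsT: "qs ! T = map (mean_term n d \<delta> T) [0..<n]"
    unfolding qs_def by (simp add: nth_append)
  have pd: "p * real d \<ge> 2" using p d mult_mono[of 2 p 1 "real d"] by simp
  have \<delta>01: "0 < \<delta>" "\<delta> < 1" unfolding \<delta> using \<epsilon> pd by (auto simp: field_simps)
  have "real n / real d \<ge> 0" by simp
  then have "ln (2 + 2 * (real n / real d)) > 0" by (intro ln_gt_zero) linarith
  then have T: "T > 0" using LT by (cases T) auto
  define W where "W h k = vec n (\<lambda>i. rterm_val h (iterate_term n d k i))" for h k
  define U where "U h = vec n (\<lambda>i. rterm_val h (mean_term n d \<delta> T i))" for h
  have iter: "approx_leverage \<delta> p A (W h k) (h ! k)"
    if "\<And>k. k < length h \<Longrightarrow> approx_leverage \<delta> p A (rterms_vec ([] @ take k h) (qs ! k)) (h ! k)" "k < length h" "k < T" for h k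
    using that(1)[OF that(2)] unfolding qsk[OF that(3)] W_def
    by (simp add: rterms_vec_map_upt rterm_val_iterate_take)
  have Ueq: "U h $ i = (1 + \<delta>) / ((1 - \<delta>)\<^sup>2 * real T) * (\<Sum>k<T. W h k $ i)" if "i < n" for h i
    unfolding U_def W_def mean_term_def using that by (simp add: rterm_val_foldr_Plus)
  have Upos: "positive_vec n (U h)" if "\<And>k. k \<le> T \<Longrightarrow> positive_vec n (W h k)" for h
  proof -
    have "(\<Sum>k<T. W h k $ i) > 0" if "i < n" for i
      using \<open>\<And>k. k \<le> T \<Longrightarrow> positive_vec n (W h k)\<close> that T unfolding positive_vec_def
      by (intro sum_pos) auto
    then show ?thesis using Ueq \<delta>01 T unfolding positive_vec_def by (auto simp: U_def)
  qed
  show ?thesis unfolding lewis_prog_def qs_def[symmetric]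
  proof (rule computes_straight_line)
    fix h assume h: "length h < length qs"
      and ans: "\<And>k. k < length h \<Longrightarrow> approx_leverage \<delta> p A (rterms_vec ([] @ take k h) (qs ! k)) (h ! k)"
    have Wpos: "positive_vec n (W h k)" if "k \<le> length h" "k \<le> T" for k
      unfolding W_def using iterates_positive(1)[OF n d \<delta>01(2) iter[OF ans, unfolded W_def] that] by blast
    show "positive_vec n (rterms_vec ([] @ h) (qs ! length h))"
    proof (cases "length h < T")
      case True
      then show ?thesis using Wpos[of "length h"] by (simp add: qsk rterms_vec_map_upt W_def)
    next
      case False
      \<comment> \<open>Only the query at the rescaled mean is left, and all iterates in it are
        known.\<close>
      then have "length h = T" using h len by simp
      then show ?thesis using Upos[of h] Wpos by (simp add: qsT rterms_vec_map_upt U_def)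
    qed
  next
    fix h assume h: "length h = length qs"
      and ans: "\<And>k. k < length h \<Longrightarrow> approx_leverage \<delta> p A (rterms_vec ([] @ take k h) (qs ! k)) (h ! k)"
    note itp = iterates_positive[OF n d \<delta>01(2) iter[OF ans, unfolded W_def], folded W_def]
    have Wpos: "positive_vec n (W h k)" if "k \<le> T" for k
      using itp(1)[of T k] that h len by simp
    have step: "approx_leverage \<delta> p A (W h k) (W h (Suc k))" if "k < T" for k
      using itp(2)[of T k] iter[OF ans] that h len by simp
    have s: "approx_leverage \<delta> p A (U h) (h ! T)"
      using ans[of T] h len by (simp add: qsT rterms_vec_map_upt U_def rterm_val_mean_take)
    define w where "w = vec n (\<lambda>i. U h $ i * (h ! T $ i / U h $ i) powr (p / 2))"
    have spos: "positive_vec n (h ! T)" by (rule approx_leverage_positive[OF Upos[OF Wpos] s \<delta>01(2)])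
    have w: "positive_vec n w"
      using Upos[OF Wpos] spos unfolding positive_vec_def w_def by (auto simp: less_imp_neq[THEN not_sym])
    have "two_sided_lewis \<epsilon> p A w"
      by (rule two_sided_lewis_of_iterates[OF \<epsilon> n d \<delta> LT Wpos _ step Upos[OF Wpos] Ueq s w])
        (auto simp: W_def iterate_term_def w_def)
    moreover have "rterms_vec ([] @ h) (map (\<lambda>i. Times (mean_term n d \<delta> T i)
        (Power (Divide (Ans T i) (mean_term n d \<delta> T i)) (Num (p / 2)))) [0..<n]) = w"
      using spos h len unfolding w_def U_def rterms_vec_map_upt positive_vec_def by (intro eq_vecI) auto
    ultimately show "two_sided_lewis \<epsilon> p A (rterms_vec ([] @ h) (map (\<lambda>i. Times (mean_term n d \<delta> T i)
        (Power (Divide (Ans T i) (mean_term n d \<delta> T i)) (Num (p / 2)))) [0..<n]))" by simp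
  qed
qed

end

section \<open>Counting the queries\<close>

lemma num_queries_lewis_prog: "num_queries (lewis_prog n d p \<delta> T) = Suc T"
  unfolding lewis_prog_def num_queries_straight_line by simp

text \<open>\<open>T\<close> is at most \<open>200 * (z * l) + 1\<close>. The rounding and the final
  query add 2 altogether, which \<open>2 * (z * l)\<close> covers because \<open>z * l\<close> is at
  least 1.\<close>

lemma query_count_le:
  fixes p \<epsilon> \<delta> :: real
  assumes n: "n \<ge> 1" and d: "d \<ge> 1" and p: "p \<ge> 2" and \<epsilon>: "0 < \<epsilon>" "\<epsilon> < 1"
    and \<delta>: "\<delta> = \<epsilon> / (100 * (p * real d))"
  defines "T \<equiv> nat \<lceil>ln (2 + 2 * (real n / real d)) / \<delta>\<rceil>"
  shows "real (Suc T) \<le> 202 * (p * real d / \<epsilon>) * ln (2 + real n / real d + p * real d / \<epsilon>)"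
proof -
  define y where "y = real n / real d"
  define z where "z = p * real d / \<epsilon>"
  have y: "y \<ge> 0" unfolding y_def by simp
  have "2 * 1 \<le> p * real d" using p d by (intro mult_mono) auto
  also have "\<dots> \<le> z" unfolding z_def using \<epsilon> p d by (simp add: field_simps)
  finally have z: "z \<ge> 2" by simp
  define l where "l = ln (2 + y + z)"
  have "ln (2::real) \<ge> 1 / 2" using ln_le_minus_one[of "1 / 2 :: real"] by (simp add: ln_div)
  moreover have "ln 2 \<le> l" unfolding l_def using y z by (intro ln_mono) auto
  ultimately have l: "l \<ge> 1 / 2" by linarith
  have zl: "z * l \<ge> 1" using mult_mono[OF z l] z by simp
  \<comment> \<open>Squaring absorbs the factor 2 inside the logarithm at the price of a factor 2
    outside.\<close>
  have "ln (2 + 2 * y) \<le> ln ((2 + y) ^ 2)" using y by (intro ln_mono) (auto simp: power2_eq_square algebra_simps)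
  also have "\<dots> = 2 * ln (2 + y)" using y by (simp add: ln_realpow)
  also have "\<dots> \<le> 2 * l" unfolding l_def using y z by simp
  finally have L: "ln (2 + 2 * y) \<le> 2 * l" .
  have L0: "ln (2 + 2 * y) \<ge> 0" using y by simp
  have div: "ln (2 + 2 * y) / \<delta> = 100 * z * ln (2 + 2 * y)"
    unfolding \<delta> z_def using \<epsilon> p d by (simp add: field_simps)
  have "real T \<le> ln (2 + 2 * y) / \<delta> + 1"
    unfolding T_def y_def[symmetric] div using L0 z of_int_ceiling_le_add_one by simp
  also have "\<dots> \<le> 100 * z * (2 * l) + 1"
    unfolding div using L z by (intro add_right_mono mult_left_mono) auto
  finally have "real (Suc T) \<le> 200 * (z * l) + 2" by simp
  also have "\<dots> \<le> 202 * (z * l)" using zl by linarith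
  finally show ?thesis unfolding z_def[symmetric] y_def[symmetric] l_def[symmetric] by (simp add: mult.assoc)
qed

text \<open>The program is chosen before \<open>A\<close>, so it depends on the dimensions,
  \<open>p\<close> and \<open>\<epsilon>\<close> only. The witnesses are \<open>c = 1/100\<close>,
  \<open>C = 202\<close> and \<open>k = 1\<close>: a single logarithmic factor suffices.\<close>

theorem theorem1p1:
  shows "\<exists>(c::real) (C::real) (k::nat)
            (alg :: nat \<Rightarrow> nat \<Rightarrow> real \<Rightarrow> real \<Rightarrow> oracle_prog).
     c > 0 \<and> C > 0 \<and>
     (\<forall>(n::nat) (d::nat) (p::real) (\<epsilon>::real).
        n \<ge> 1 \<longrightarrow> d \<ge> 1 \<longrightarrow> p \<ge> 2 \<longrightarrow> 0 < \<epsilon> \<longrightarrow> \<epsilon> < 1 \<longrightarrow>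
          real (num_queries (alg n d p \<epsilon>))
            \<le> C * (p * real d / \<epsilon>) * (ln (2 + real n / real d + p * real d / \<epsilon>)) ^ k \<and>
          (\<forall>A \<in> carrier_mat n d. (\<forall>i<n. row A i \<noteq> 0\<^sub>v d) \<longrightarrow>
             computes (positive_vec n)
                      (approx_leverage (c * \<epsilon> / (p * real d)) p A)
                      (two_sided_lewis \<epsilon> p A)
                      (alg n d p \<epsilon>) []))"
proof -
  define \<delta> where "\<delta> d p \<epsilon> = \<epsilon> / (100 * (p * real d))" for d :: nat and p \<epsilon> :: real
  define T where "T n d p \<epsilon> = nat \<lceil>ln (2 + 2 * (real n / real d)) / \<delta> d p \<epsilon>\<rceil>" for n d :: nat and p \<epsilon> :: real
  define alg where "alg n d p \<epsilon> = lewis_prog n d p (\<delta> d p \<epsilon>) (T n d p \<epsilon>)" for n d p \<epsilon>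
  have count: "real (num_queries (alg n d p \<epsilon>))
      \<le> 202 * (p * real d / \<epsilon>) * (ln (2 + real n / real d + p * real d / \<epsilon>)) ^ 1"
    if "n \<ge> 1" "d \<ge> 1" "p \<ge> 2" "0 < \<epsilon>" "\<epsilon> < 1" for n d :: nat and p \<epsilon> :: real
    using query_count_le[OF that \<delta>_def] unfolding alg_def num_queries_lewis_prog T_def by simp
  have correct: "computes (positive_vec n) (approx_leverage (1 / 100 * \<epsilon> / (p * real d)) p A)
      (two_sided_lewis \<epsilon> p A) (alg n d p \<epsilon>) []"
    if "n \<ge> 1" "d \<ge> 1" "p \<ge> 2" "0 < \<epsilon>" "\<epsilon> < 1" and A: "A \<in> carrier_mat n d" "\<forall>i<n. row A i \<noteq> 0\<^sub>v d"
    for n d :: nat and p \<epsilon> :: real and A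
  proof -
    interpret nonzero_rows A n d p using that by unfold_locales auto
    have "\<delta> d p \<epsilon> > 0" unfolding \<delta>_def using that by simp
    moreover have "ln (2 + 2 * (real n / real d)) / \<delta> d p \<epsilon> \<le> real (T n d p \<epsilon>)"
      unfolding T_def by (rule real_nat_ceiling_ge)
    ultimately have "ln (2 + 2 * (real n / real d)) \<le> \<delta> d p \<epsilon> * real (T n d p \<epsilon>)"
      by (simp only: pos_divide_le_eq mult.commute)
    from computes_lewis_prog[OF that(4,5,1,2) \<delta>_def this]
    show ?thesis unfolding alg_def \<delta>_def by simp
  qed
  show ?thesis
  proof (rule exI[of _ "1 / 100"], rule exI[of _ 202], rule exI[of _ 1], rule exI[of _ alg],
      intro conjI allI impI ballI)
    show "(1 / 100 :: real) > 0" "(202 :: real) > 0" by simp_all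
  next
    fix n d :: nat and p \<epsilon> :: real
    assume 1: "n \<ge> 1" "d \<ge> 1" "p \<ge> 2" "0 < \<epsilon>" "\<epsilon> < 1"
    show "real (num_queries (alg n d p \<epsilon>))
      \<le> 202 * (p * real d / \<epsilon>) * (ln (2 + real n / real d + p * real d / \<epsilon>)) ^ 1"
      by (rule count[OF 1])
    fix A :: "real mat" assume "A \<in> carrier_mat n d" "\<forall>i<n. row A i \<noteq> 0\<^sub>v d"
    then show "computes (positive_vec n) (approx_leverage (1 / 100 * \<epsilon> / (p * real d)) p A)
      (two_sided_lewis \<epsilon> p A) (alg n d p \<epsilon>) []"
      by (rule correct[OF 1])
  qed
qed

end
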